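(* Let $r\geq 2$ be an integer, let $n$ be a positive integer, let $c$ be a real number with $2/\ln n\leq c\leq r^{-(r+7)(r+1)}/2$, let $0<\alpha<r^{-8}/8$, and let $G$ be a graph of order $n$ with exactly $\lceil (1-1/r-\alpha)n^2/2\rceil$ edges. Then at least one of the following holds: (i) $G$ contains a (not necessarily induced) subgraph isomorphic to $K_r^+\left(\lfloor c\ln n\rfloor,\ldots,\lfloor c\ln n\rfloor,\lceil n^{1-2\sqrt{c}}\rceil\right)$, where the first $r-1$ parts have size $\lfloor c\ln n\rfloor$ and the last part has size $\lceil n^{1-2\sqrt{c}}\rceil$; (ii) $G$ contains an induced subgraph $G_0$ which is $r$-partite (i.e. $r$-colorable), has order at least $(1-\sqrt{2\alpha})n$, and has minimum degree $\delta(G_0)>(1-1/r-2\sqrt{2\alpha})n$.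
   Context: For integers $s_1\geq 2,s_2,\ldots,s_r\geq 1$, $K_r^+(s_1,\ldots,s_r)$ denotes the complete $r$-partite graph with parts of sizes $s_1,\ldots,s_r$ together with one additional edge joining two vertices of the first part (the part of size $s_1$). $\delta(H)$ denotes the minimum degree of a graph $H$. *)

theory Defs
  imports Complex_Main "HOL-Library.Ramsey"
begin

type_synonym 'a graph = "'a set \<times> 'a set set"

abbreviation verts :: "'a graph \<Rightarrow> 'a set" where
  "verts G \<equiv> fst G"

abbreviation edges :: "'a graph \<Rightarrow> 'a set set" where
  "edges G \<equiv> snd G"

definition simple_graph :: "'a graph \<Rightarrow> bool" where
  "simple_graph G \<longleftrightarrow> finite (verts G) \<and> edges G \<subseteq> [verts G]\<^bsup>2\<^esup>"

definition subgraph :: "'a graph \<Rightarrow> 'a graph \<Rightarrow> bool" where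
  "subgraph H G \<longleftrightarrow> simple_graph H \<and> verts H \<subseteq> verts G \<and> edges H \<subseteq> edges G"

definition induced_subgraph :: "'a graph \<Rightarrow> 'a graph \<Rightarrow> bool" where
  "induced_subgraph H G \<longleftrightarrow>
     verts H \<subseteq> verts G \<and> edges H = {e \<in> edges G. e \<subseteq> verts H}"

definition isomorphic :: "'a graph \<Rightarrow> 'b graph \<Rightarrow> bool" where
  "isomorphic G H \<longleftrightarrow>
     (\<exists>f. bij_betw f (verts G) (verts H) \<and> edges H = (\<lambda>e. f ` e) ` edges G)"

definition degree :: "'a graph \<Rightarrow> 'a \<Rightarrow> nat" where
  "degree G v = card {e \<in> edges G. v \<in> e}"

definition min_degree :: "'a graph \<Rightarrow> nat" where
  "min_degree G = Min (degree G ` verts G)"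

text \<open>Parts are allowed to be empty, so this is the same as being \<open>r\<close>-colorable.\<close>

definition partite :: "nat \<Rightarrow> 'a graph \<Rightarrow> bool" where
  "partite r G \<longleftrightarrow>
     (\<exists>col. col ` verts G \<subseteq> {..<r} \<and>
        (\<forall>u v. {u, v} \<in> edges G \<longrightarrow> col u \<noteq> col v))"

text \<open>
  The vertex \<open>(i, j)\<close> is the \<open>j\<close>-th vertex of the \<open>i\<close>-th part, with both indices counted from 0.
  The first part has to have size at least 2 to accommodate the additional edge.
\<close>

definition K_plus :: "nat list \<Rightarrow> (nat \<times> nat) graph" where
  "K_plus s =
     (let V = {(i, j). i < length s \<and> j < s ! i}
      in (V, {{u, v} | u v. u \<in> V \<and> v \<in> V \<and> fst u \<noteq> fst v} \<union> {{(0, 0), (0, 1)}}))"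

lemma simple_graph_K_plus:
  assumes "s \<noteq> []" "s ! 0 \<ge> 2"
  shows "simple_graph (K_plus s)"
proof -
  have "{(i, j). i < length s \<and> j < s ! i} = (SIGMA i:{..<length s}. {..<s ! i})"
    by auto
  then have "finite {(i, j). i < length s \<and> j < s ! i}"
    by simp
  then show ?thesis
    using assms by (auto simp: simple_graph_def K_plus_def Let_def nsets_def card_2_iff)
qed

end

theory Submission imports Defs begin

text \<open>
  Write \<open>\<epsilon> = r\<^sup>-\<^sup>4\<close> and call a graph on \<open>N\<close> vertices dense if its minimum degree exceeds
  \<open>(1 - 1/r - \<epsilon>) N\<close>. A dense graph without \<open>K\<^bsub>r+1\<^esub>\<close> is \<open>r\<close>-colorable: for an \<open>r\<close>-clique, the sets of
  common neighbours of its \<open>(r-1)\<close>-subsets are almost all of the graph, and every vertex misses one of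
  them completely. In a dense graph with a \<open>K\<^bsub>r+1\<^esub>\<close>, exchanging the vertices of the clique one at a
  time shows that some edge \<open>uv\<close> lies in a positive proportion of all possible \<open>(r+1)\<close>-cliques.
  Together with the common neighbours of the remaining \<open>r-1\<close> vertices this gives at least
  \<open>N\<^sup>r / r\<^bsup>r+7\<^esup>\<close> ordered \<open>r\<close>-cliques all of whose vertices but the last are adjacent to \<open>u\<close> and \<open>v\<close>,
  and an iterated Kovari-Sos-Turan argument turns them into the required \<open>K\<^sub>r\<^sup>+\<close>; the loss of a
  constant factor in \<open>N\<close> does not matter, because \<open>n\<^bsup>sqrt c\<^esup>\<close> is huge.

  Let \<open>x = sqrt (2 \<alpha>) n\<close>. If at most \<open>x\<close> vertices have degree at most \<open>(1 - 1/r) n - x\<close>, deleting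
  them leaves a dense graph. Otherwise deleting \<open>\<lfloor>x\<rfloor>\<close> of them leaves more than \<open>(1 - 1/r) m\<^sup>2 / 2\<close> edges
  on \<open>m\<close> vertices, and deleting further vertices of low degree leads to a dense graph that still has
  too many edges to be \<open>r\<close>-colorable. If \<open>x < 1\<close> nothing may be deleted, but then a dense \<open>r\<close>-colorable
  \<open>G\<close> has to be complete \<open>r\<close>-partite with balanced parts.
\<close>

section \<open>Graphs of large minimum degree\<close>

lemma real_card_UN_le:
  assumes "finite I"
  shows "real (card (\<Union>i\<in>I. A i)) \<le> (\<Sum>i\<in>I. real (card (A i)))"
  using card_UN_le[OF assms, of A] by (metis of_nat_mono of_nat_sum)

text \<open>Representatives are picked one at a time: each earlier choice rules out at most
  \<open>m\<close> elements of the next set, so one survives. This completes edges to forbidden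
  cliques in \<open>colorable_if_clique_free\<close>.\<close>

lemma greedy_transversal:
  fixes m :: real
  assumes "finite J" and "\<And>j. j \<in> J \<Longrightarrow> finite (A j)"
    and sym: "\<And>x y. adj x y \<Longrightarrow> adj y x"
    and miss: "\<And>j k y. j \<in> J \<Longrightarrow> k \<in> J \<Longrightarrow> j \<noteq> k \<Longrightarrow> y \<in> A j \<Longrightarrow>
      real (card {z \<in> A k. \<not> adj y z}) \<le> m"
    and "m \<ge> 0"
    and "\<And>k. k \<in> J \<Longrightarrow> real (card (A k)) > (real (card J) - 1) * m"
  shows "\<exists>u. (\<forall>j\<in>J. u j \<in> A j) \<and> (\<forall>j\<in>J. \<forall>k\<in>J. j \<noteq> k \<longrightarrow> adj (u j) (u k))"
  using assms(1,2,4,6)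
proof (induction J rule: finite_induct)
  case empty
  then show ?case by simp
next
  case (insert i J)
  have c: "real (card (insert i J)) - 1 = card J"
    using insert.hyps by simp
  have "\<exists>u. (\<forall>j\<in>J. u j \<in> A j) \<and> (\<forall>j\<in>J. \<forall>k\<in>J. j \<noteq> k \<longrightarrow> adj (u j) (u k))"
  proof (rule insert.IH)
    fix k assume "k \<in> J"
    have "(real (card J) - 1) * m \<le> card J * m"
      using \<open>m \<ge> 0\<close> by (simp add: algebra_simps)
    also have "\<dots> < card (A k)"
      using insert.prems(3)[of k] \<open>k \<in> J\<close> c by simp
    finally show "(real (card J) - 1) * m < card (A k)" .
  qed (use insert.prems in auto)
  then obtain u where u: "\<forall>j\<in>J. u j \<in> A j" "\<forall>j\<in>J. \<forall>k\<in>J. j \<noteq> k \<longrightarrow> adj (u j) (u k)"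
    by blast
  have "real (card (\<Union>j\<in>J. {z \<in> A i. \<not> adj (u j) z})) \<le> (\<Sum>j\<in>J. real (card {z \<in> A i. \<not> adj (u j) z}))"
    using insert.hyps(1) by (rule real_card_UN_le)
  also have "\<dots> \<le> (\<Sum>j\<in>J. m)"
  proof (rule sum_mono)
    fix j assume "j \<in> J"
    then show "real (card {z \<in> A i. \<not> adj (u j) z}) \<le> m"
      using insert.hyps u(1) by (intro insert.prems(2)[of j i]) auto
  qed
  also have "\<dots> = card J * m"
    by simp
  also have "\<dots> < card (A i)"
    using insert.prems(3)[of i] c by simp
  finally have "card (\<Union>j\<in>J. {z \<in> A i. \<not> adj (u j) z}) < card (A i)"
    by simp
  then have "\<not> A i \<subseteq> (\<Union>j\<in>J. {z \<in> A i. \<not> adj (u j) z})"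
    using insert.prems(1)[of i] card_mono[of "\<Union>j\<in>J. {z \<in> A i. \<not> adj (u j) z}" "A i"] insert.hyps
    by (auto simp: not_le[symmetric])
  then obtain z where z: "z \<in> A i" "\<forall>j\<in>J. adj (u j) z"
    by auto
  show ?case
    by (rule exI[of _ "u(i := z)"]) (use u z insert.hyps sym in auto)
qed

text \<open>The pairs of a list and an admissible extension inject into \<open>T'\<close>. The
  constructor \<open>f\<close> is abstract because lists grow at the head in
  \<open>exchange_lists\<close> and at the end in \<open>joint_lists\<close>.\<close>

lemma card_list_extensions_ge:
  fixes a :: real
  assumes "finite T'" and "\<And>l. l \<in> T \<Longrightarrow> finite (X l)"
    and "\<And>l x. l \<in> T \<Longrightarrow> x \<in> X l \<Longrightarrow> f x l \<in> T'"
    and inj: "\<And>l l' x x'. f x l = f x' l' \<Longrightarrow> x = x' \<and> l = l'"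
    and "finite T" and "\<And>l. l \<in> T \<Longrightarrow> real (card (X l)) \<ge> a"
  shows "real (card T') \<ge> a * real (card T)"
proof -
  have "a * real (card T) = (\<Sum>l\<in>T. a)"
    by simp
  also have "\<dots> \<le> (\<Sum>l\<in>T. real (card (X l)))"
    by (rule sum_mono) (use assms in auto)
  also have "\<dots> = card (SIGMA l:T. X l)"
    using assms by (simp add: card_SigmaI)
  also have "\<dots> = card ((\<lambda>(l, x). f x l) ` (SIGMA l:T. X l))"
    by (subst card_image) (auto simp: inj_on_def dest: inj)
  also have "\<dots> \<le> card T'"
    using assms by (intro of_nat_mono card_mono) auto
  finally show ?thesis .
qed

text \<open>Lets the factorial produced by the exchange argument cancel the powers of 4 in
  \<open>(4 * real r) ^ (r - 1)\<close>. From m = 3 on, each step multiplies the right side by at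
  least 4.\<close>

lemma four_power_le_fact: "4 ^ m \<le> 16 * (fact m :: nat)"
proof -
  consider "m = 0" | "m = 1" | "m = 2" | "m \<ge> 3"
    by linarith
  then show ?thesis
  proof cases
    case 4
    then show ?thesis
    proof (induction m rule: dec_induct)
      case base
      then show ?case by (simp add: fact_numeral)
    next
      case (step m)
      have "4 ^ Suc m \<le> 4 * (16 * (fact m :: nat))"
        using step by simp
      also have "\<dots> \<le> Suc m * (16 * fact m)"
        using step by (intro mult_right_mono) auto
      finally show ?case by (simp add: algebra_simps)
    qed
  qed (auto simp: fact_numeral)
qed

lemma prod_rev_fact: "(\<Prod>i<m. real (m - i)) = fact m"
proof -
  have "(\<Prod>i<m. real (m - i)) = (\<Prod>i<m. real (Suc i))"
    by (rule prod.reindex_bij_witness[of _ "\<lambda>i. m - Suc i" "\<lambda>i. m - Suc i"]) auto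
  also have "\<dots> = fact m"
    by (induction m) (auto simp: algebra_simps)
  finally show ?thesis .
qed

text \<open>Adjacency is a relation not tied to \<open>V\<close>, so passing to a subset of the
  vertices needs no new graph. The degree condition is phrased through non-neighbours, which are
  what union bounds add up; every vertex counts as its own non-neighbour.\<close>

locale dense_graph =
  fixes V :: "'a set" and adj :: "'a \<Rightarrow> 'a \<Rightarrow> bool" and r :: nat
  assumes finite_V: "finite V" and V_ne: "V \<noteq> {}" and r_ge: "r \<ge> 2"
    and sym: "adj x y \<Longrightarrow> adj y x" and irrefl: "\<not> adj x x"
    and nonadj: "v \<in> V \<Longrightarrow>
      real (card {x \<in> V. \<not> adj v x}) < (1 / real r + 1 / real r ^ 4) * real (card V)"
begin

definition N :: real where "N = real (card V)"
definition d :: real where "d = (1 / real r + 1 / real r ^ 4) * N"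

section \<open>Common neighbourhoods, cliques and colourings of dense graphs\<close>

lemma N_pos: "N > 0"
  using finite_V V_ne by (simp add: N_def card_gt_0_iff)

lemma d_pos: "d > 0"
  using N_pos r_ge by (simp add: d_def add_pos_pos)

lemma nonadj_less: "v \<in> V \<Longrightarrow> card {x \<in> V. \<not> adj v x} < d"
  using nonadj by (simp add: d_def N_def)

lemma card_common_ge:
  assumes "W \<subseteq> V"
  shows "card {x \<in> V. \<forall>w\<in>W. adj w x} \<ge> N - card W * d"
proof -
  have fW: "finite W"
    using assms finite_V finite_subset by blast
  have "card V \<le> card ({x \<in> V. \<forall>w\<in>W. adj w x} \<union> (\<Union>w\<in>W. {x \<in> V. \<not> adj w x}))"
    by (rule card_mono) (use finite_V fW in auto)
  also have "\<dots> \<le> card {x \<in> V. \<forall>w\<in>W. adj w x} + card (\<Union>w\<in>W. {x \<in> V. \<not> adj w x})"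
    by (rule card_Un_le)
  finally have "N \<le> card {x \<in> V. \<forall>w\<in>W. adj w x} + real (card (\<Union>w\<in>W. {x \<in> V. \<not> adj w x}))"
    unfolding N_def by linarith
  moreover have "real (card (\<Union>w\<in>W. {x \<in> V. \<not> adj w x})) \<le> (\<Sum>w\<in>W. real (card {x \<in> V. \<not> adj w x}))"
    using fW by (rule real_card_UN_le)
  moreover have "(\<Sum>w\<in>W. real (card {x \<in> V. \<not> adj w x})) \<le> (\<Sum>w\<in>W. d)"
    using assms nonadj_less by (intro sum_mono less_imp_le) auto
  ultimately show ?thesis
    by simp
qed

text \<open>The non-neighbourhoods of \<open>r\<close> vertices overshoot \<open>N\<close> in total
  by at most N / r^3; this overshoot is the error term \<open>m\<close> of
  \<open>colorable_if_clique_free\<close>.\<close>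

lemma mult_d: "real r * d = N + N / real r ^ 3"
  using r_ge by (simp add: d_def field_simps power_numeral_reduce)

text \<open>Makes \<open>card_common_ge\<close> useful for fewer than \<open>r\<close> vertices. For
  \<open>k = r - 1\<close> the left side is N/r - N/r^3 + N/r^4, and the middle term is at most half
  of the first.\<close>

lemma common_of_few_pos:
  assumes "k < r"
  shows "N - real k * d > N / (2 * real r)"
proof -
  have r: "real r \<ge> 2"
    using r_ge by simp
  have "real k * d \<le> (real r - 1) * d"
    using assms d_pos by (intro mult_right_mono) auto
  also have "\<dots> = N + N / real r ^ 3 - N / real r - N / real r ^ 4"
    using r mult_d by (simp add: left_diff_distrib) (simp add: d_def algebra_simps)
  finally have 1: "N - real k * d \<ge> N / real r - N / real r ^ 3 + N / real r ^ 4"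
    by simp
  have "2 * real r \<le> real r ^ 3"
    using power_mono[OF r, of 2] r by (simp add: power_numeral_reduce)
  then have "N / real r ^ 3 \<le> N / (2 * real r)"
    using N_pos r by (intro divide_left_mono) auto
  moreover have "N / real r = 2 * (N / (2 * real r))"
    using r by simp
  moreover have "N / real r ^ 4 > 0"
    using N_pos r by simp
  ultimately show ?thesis
    using 1 by linarith
qed

lemma clique_exists:
  assumes "k \<le> r"
  shows "\<exists>K\<subseteq>V. card K = k \<and> pairwise adj K"
  using assms
proof (induction k)
  case 0
  then show ?case by (intro exI[of _ "{}"]) auto
next
  case (Suc k)
  then obtain K where K: "K \<subseteq> V" "card K = k" "pairwise adj K"
    by auto
  have "N / (2 * real r) > 0"
    using N_pos r_ge by simp
  then have "card {x \<in> V. \<forall>w\<in>K. adj w x} > (0::real)"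
    using card_common_ge[OF K(1)] common_of_few_pos[of k] K(2) Suc.prems by simp
  then obtain x where x: "x \<in> V" "\<forall>w\<in>K. adj w x"
    by (metis (mono_tags, lifting) card.empty empty_Collect_eq less_irrefl of_nat_0)
  show ?case
    using K x irrefl sym finite_subset[OF K(1) finite_V]
    by (intro exI[of _ "insert x K"]) (auto simp: pairwise_insert card_insert_if)
qed

text \<open>Fix an r-clique and let \<open>A i\<close> consist of the common neighbours of all its
  vertices but the i-th. Without a clique on r + 1 vertices these sets are independent and disjoint,
  and each has about N/r elements or more. A vertex gets as its colour the index of a set
  \<open>A i\<close> in which it has no neighbour.\<close>

lemma colorable_if_clique_free:
  assumes free: "\<And>K. K \<subseteq> V \<Longrightarrow> card K = r + 1 \<Longrightarrow> pairwise adj K \<Longrightarrow> False"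
  shows "\<exists>col. (\<forall>x\<in>V. col x < r) \<and> (\<forall>x\<in>V. \<forall>y\<in>V. adj x y \<longrightarrow> col x \<noteq> col y)"
proof -
  have r: "real r \<ge> 2"
    using r_ge by simp
  obtain K where K: "K \<subseteq> V" "card K = r" "pairwise adj K"
    using clique_exists[of r] by auto
  have fK: "finite K"
    using K(1) finite_V finite_subset by blast
  then obtain v where v: "bij_betw v {0..<r} K"
    using ex_bij_betw_nat_finite[OF fK] K(2) by auto
  have vV: "v j \<in> V" if "j < r" for j
    using v that K(1) by (auto simp: bij_betw_def)
  have vadj: "adj (v j) (v k)" if "j < r" "k < r" "j \<noteq> k" for j k
    using v that K(3) unfolding pairwise_def bij_betw_def inj_on_def by (metis atLeastLessThan_iff imageI zero_le)
  have injv: "inj_on v S" if "S \<subseteq> {0..<r}" for S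
    using v that by (auto simp: bij_betw_def intro: inj_on_subset)
  define A where "A i = {x \<in> V. \<forall>j<r. j \<noteq> i \<longrightarrow> adj (v j) x}" for i
  have AV: "A i \<subseteq> V" for i
    by (auto simp: A_def)
  have fA: "finite (A i)" for i
    using AV finite_V finite_subset by blast
  define a where "a = N - (real r - 1) * d"
  have cardA: "card (A i) \<ge> a" if "i < r" for i
  proof -
    have "card (v ` ({0..<r} - {i})) = r - 1"
      using that by (subst card_image) (auto intro: injv)
    moreover have "A i = {x \<in> V. \<forall>w\<in>v ` ({0..<r} - {i}). adj w x}"
      by (auto simp: A_def)
    moreover have "v ` ({0..<r} - {i}) \<subseteq> V"
      using vV by auto
    ultimately show ?thesis
      using card_common_ge[of "v ` ({0..<r} - {i})"] r_ge by (simp add: a_def of_nat_diff)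
  qed
  have indep: "\<not> adj x y" if "i < r" "x \<in> A i" "y \<in> A i" for i x y
  proof
    assume xy: "adj x y"
    let ?W = "v ` ({0..<r} - {i})"
    have xW: "adj x w \<and> adj y w \<and> adj w x \<and> adj w y" if "w \<in> ?W" for w
      using that \<open>x \<in> A i\<close> \<open>y \<in> A i\<close> sym by (auto simp: A_def)
    have "card ?W = r - 1"
      using that by (subst card_image) (auto intro: injv)
    moreover have "x \<notin> ?W" "y \<notin> ?W" "x \<noteq> y"
      using xW irrefl xy by blast+
    ultimately have "card (insert x (insert y ?W)) = r + 1"
      using r_ge by simp
    moreover have "pairwise adj ?W"
      by (rule pairwiseI) (use vadj in force)
    then have "pairwise adj (insert x (insert y ?W))"
      using xW xy sym by (auto simp: pairwise_insert)
    moreover have "insert x (insert y ?W) \<subseteq> V"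
      using that AV vV by auto
    ultimately show False
      using free by blast
  qed
  have disj: "A i \<inter> A j = {}" if "i < r" "j < r" "i \<noteq> j" for i j
  proof (rule ccontr)
    assume "A i \<inter> A j \<noteq> {}"
    then obtain x where x: "x \<in> A i" "x \<in> A j"
      by auto
    then have xK: "adj w x" if "w \<in> K" for w
      using that v \<open>i \<noteq> j\<close> by (auto simp: A_def bij_betw_def)
    then have "x \<notin> K"
      using irrefl by blast
    then have "card (insert x K) = r + 1"
      using K fK by simp
    moreover have "pairwise adj (insert x K)"
      using K xK sym by (auto simp: pairwise_insert)
    moreover have "insert x K \<subseteq> V"
      using K x AV by auto
    ultimately show False
      using free by blast
  qed
  \<comment> \<open>\<open>m\<close> equals \<open>d - a\<close>: a vertex without neighbours in
    \<open>A i\<close> already has at least \<open>a\<close> of its fewer than \<open>d\<close>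
    non-neighbours there, which leaves at most \<open>m\<close> for any other
    \<open>A j\<close>.\<close>
  define m where "m = N / real r ^ 3"
  have m: "m \<ge> 0"
    using N_pos by (simp add: m_def)
  have miss: "card {z \<in> A j. \<not> adj x z} \<le> m"
    if "i < r" "j < r" "i \<noteq> j" "x \<in> V" "\<And>y. y \<in> A i \<Longrightarrow> \<not> adj x y" for i j x
  proof -
    have "card (A i) + card {z \<in> A j. \<not> adj x z} = card (A i \<union> {z \<in> A j. \<not> adj x z})"
      using disj[of i j] that fA by (intro card_Un_disjoint[symmetric]) auto
    also have "\<dots> \<le> card {z \<in> V. \<not> adj x z}"
      using that AV finite_V by (intro card_mono) auto
    finally have "real (card (A i)) + card {z \<in> A j. \<not> adj x z} \<le> d"
      using nonadj_less[OF \<open>x \<in> V\<close>] by linarith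
    moreover have "d - a = m"
      unfolding a_def m_def using mult_d by (simp add: algebra_simps)
    ultimately show ?thesis
      using cardA[OF \<open>i < r\<close>] by linarith
  qed
  \<comment> \<open>If an edge has more than \<open>(r - 2) * m\<close> common neighbours in each of
    the r - 1 sets other than \<open>A i\<close>, a transversal of these common neighbours completes
    it to a forbidden clique.\<close>
  have extend: False
    if xy: "x \<in> V" "y \<in> V" "adj x y" and i: "i < r"
      and big: "\<And>j. j < r \<Longrightarrow> j \<noteq> i \<Longrightarrow> card {z \<in> A j. adj x z \<and> adj y z} > (real r - 2) * m" for x y i
  proof -
    let ?J = "{0..<r} - {i}"
    let ?A = "\<lambda>j. {z \<in> A j. adj x z \<and> adj y z}"
    have cJ: "card ?J = r - 1"
      using i by simp
    have "\<exists>u. (\<forall>j\<in>?J. u j \<in> ?A j) \<and> (\<forall>j\<in>?J. \<forall>k\<in>?J. j \<noteq> k \<longrightarrow> adj (u j) (u k))"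
    proof (rule greedy_transversal)
      fix j k w assume jk: "j \<in> ?J" "k \<in> ?J" "j \<noteq> k" "w \<in> ?A j"
      have "card {z \<in> ?A k. \<not> adj w z} \<le> card {z \<in> A k. \<not> adj w z}"
        using fA by (intro card_mono) auto
      also have "real \<dots> \<le> m"
        using jk AV by (intro miss[of j k]) (auto dest: indep)
      finally show "card {z \<in> ?A k. \<not> adj w z} \<le> m" by simp
    next
      fix k assume "k \<in> ?J"
      then show "(real (card ?J) - 1) * m < card (?A k)"
        using big[of k] cJ r_ge by (simp add: of_nat_diff)
    qed (use fA sym m in auto)
    then obtain u where u: "\<And>j. j \<in> ?J \<Longrightarrow> u j \<in> ?A j"
      "\<And>j k. j \<in> ?J \<Longrightarrow> k \<in> ?J \<Longrightarrow> j \<noteq> k \<Longrightarrow> adj (u j) (u k)"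
      by blast
    have "inj_on u ?J"
      using u(2) irrefl by (metis inj_onI)
    then have c: "card (u ` ?J) = r - 1"
      using cJ card_image by metis
    have nbr: "adj x w \<and> adj y w \<and> adj w x \<and> adj w y" if "w \<in> u ` ?J" for w
      using that u(1) sym by blast
    then have "x \<notin> u ` ?J" "y \<notin> u ` ?J" "x \<noteq> y"
      using irrefl xy by blast+
    then have "card (insert x (insert y (u ` ?J))) = r + 1"
      using c r_ge by simp
    moreover have "pairwise adj (u ` ?J)"
      using u(2) by (intro pairwiseI) blast
    then have "pairwise adj (insert x (insert y (u ` ?J)))"
      using nbr xy sym by (auto simp: pairwise_insert)
    moreover have "insert x (insert y (u ` ?J)) \<subseteq> V"
      using u(1) xy AV by blast
    ultimately show False
      using free by blast
  qed
  have a1: "a = N / real r - N / real r ^ 3 + N / real r ^ 4"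
    using r mult_d by (simp add: a_def left_diff_distrib) (simp add: d_def algebra_simps)
  have "\<exists>i<r. \<forall>y\<in>A i. \<not> adj x y" if x: "x \<in> V" for x
  proof (rule ccontr)
    assume "\<not> ?thesis"
    then have nb: "\<And>i. i < r \<Longrightarrow> \<exists>y\<in>A i. adj x y"
      by auto
    \<comment> \<open>The index with the fewest neighbours of \<open>x\<close> is chosen:
      \<open>x\<close> misses fewer than \<open>d\<close> vertices of \<open>A i\<close> and
      \<open>A j\<close> together, so \<open>b i \<le> b j\<close> gives b j > a - d/2. A neighbour
      \<open>y\<close> in \<open>A i\<close> then costs at most \<open>m\<close> more.\<close>
    define b where "b i = card {z \<in> A i. adj x z}" for i
    obtain i where i: "i < r" "\<And>j. j < r \<Longrightarrow> b i \<le> b j"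
      using ex_is_arg_min_if_finite[of "{..<r}" b] r_ge
      by (auto simp: is_arg_min_linorder lessThan_empty_iff)
    obtain y where y: "y \<in> A i" "adj x y"
      using nb i by auto
    show False
    proof (rule extend[of x y i])
      fix j assume j: "j < r" "j \<noteq> i"
      have split: "card (A k) = b k + card {z \<in> A k. \<not> adj x z}" for k
      proof -
        have "A k = {z \<in> A k. adj x z} \<union> {z \<in> A k. \<not> adj x z}" by auto
        then show ?thesis unfolding b_def
          using card_Un_disjoint[of "{z \<in> A k. adj x z}" "{z \<in> A k. \<not> adj x z}"] fA by auto
      qed
      have "card {z \<in> A i. \<not> adj x z} + card {z \<in> A j. \<not> adj x z}
          = card ({z \<in> A i. \<not> adj x z} \<union> {z \<in> A j. \<not> adj x z})"
        using disj[of i j] i j fA by (intro card_Un_disjoint[symmetric]) auto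
      also have "\<dots> \<le> card {z \<in> V. \<not> adj x z}"
        using AV finite_V by (intro card_mono) auto
      finally have "real (card {z \<in> A i. \<not> adj x z}) + card {z \<in> A j. \<not> adj x z} < d"
        using nonadj_less[OF x] by linarith
      then have "2 * real (b j) > 2 * a - d"
        using split[of i] split[of j] cardA[of i] cardA[of j] i(1) i(2)[of j] j by linarith
      moreover have "b j \<le> card ({z \<in> A j. adj x z \<and> adj y z} \<union> {z \<in> A j. \<not> adj y z})"
        unfolding b_def using fA by (intro card_mono) auto
      then have "b j \<le> card {z \<in> A j. adj x z \<and> adj y z} + card {z \<in> A j. \<not> adj y z}"
        using card_Un_le le_trans by blast
      moreover have "card {z \<in> A j. \<not> adj y z} \<le> m"
        using i(1) j y AV[of i] by (intro miss[of i j]) (auto dest: indep)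
      moreover have "2 * a - d \<ge> 2 * ((real r - 1) * m)"
      proof -
        have "2 * a - d - 2 * ((real r - 1) * m) = N * (real r ^ 3 - 2 * real r ^ 2 + 1) / real r ^ 4"
          unfolding a1 m_def d_def using r by (simp add: field_simps power_numeral_reduce)
        moreover have "real r ^ 3 - 2 * real r ^ 2 + 1 \<ge> 0"
          using mult_right_mono[OF r, of "real r ^ 2"] by (simp add: power_numeral_reduce)
        ultimately show ?thesis
          using N_pos r by (smt (verit, best) divide_nonneg_nonneg mult_nonneg_nonneg zero_le_power)
      qed
      ultimately show "card {z \<in> A j. adj x z \<and> adj y z} > (real r - 2) * m"
        by (simp add: algebra_simps)
    qed (use x y AV i in auto)
  qed
  then obtain col where col: "\<And>x. x \<in> V \<Longrightarrow> col x < r \<and> (\<forall>y\<in>A (col x). \<not> adj x y)"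
    by metis
  have "col x \<noteq> col y" if xy: "x \<in> V" "y \<in> V" "adj x y" for x y
  proof
    assume eq: "col x = col y"
    \<comment> \<open>Adjacent vertices of the same colour each miss at most \<open>m\<close>
      vertices of every other \<open>A j\<close>. At least \<open>a - 2 * m\<close> common
      neighbours remain, and \<open>a > r * m\<close> suffices for \<open>extend\<close>.\<close>
    show False
    proof (rule extend[OF xy])
      show "col x < r" using col xy by blast
    next
      fix j assume j: "j < r" "j \<noteq> col x"
      have "card (A j) \<le> card ({z \<in> A j. adj x z \<and> adj y z} \<union> ({z \<in> A j. \<not> adj x z} \<union> {z \<in> A j. \<not> adj y z}))"
        using fA by (intro card_mono) auto
      also have "\<dots> \<le> card {z \<in> A j. adj x z \<and> adj y z} + (card {z \<in> A j. \<not> adj x z} + card {z \<in> A j. \<not> adj y z})"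
        by (meson add_left_mono card_Un_le le_trans)
      finally have "card (A j) \<le> card {z \<in> A j. adj x z \<and> adj y z} + (card {z \<in> A j. \<not> adj x z} + card {z \<in> A j. \<not> adj y z})" .
      moreover have "card {z \<in> A j. \<not> adj x z} \<le> m"
        using j xy col by (intro miss[of "col x" j]) auto
      moreover have "card {z \<in> A j. \<not> adj y z} \<le> m"
        using j xy col eq by (intro miss[of "col y" j]) auto
      moreover have "a > real r * m"
      proof -
        have "a - real r * m = N * (real r ^ 3 - real r ^ 2 - real r + 1) / real r ^ 4"
          unfolding a1 m_def using r by (simp add: field_simps power_numeral_reduce)
        moreover have "real r ^ 3 - real r ^ 2 - real r + 1 = (real r - 1)^2 * (real r + 1)"
          by (simp add: power_numeral_reduce algebra_simps)
        ultimately show ?thesis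
          using N_pos r by (smt (verit, best) divide_pos_pos mult_pos_pos zero_less_power)
      qed
      ultimately show "card {z \<in> A j. adj x z \<and> adj y z} > (real r - 2) * m"
        using cardA[OF j(1)] by (simp add: algebra_simps)
    qed
  qed
  then show ?thesis
    using col by blast
qed

subsection \<open>Edges in many cliques\<close>

text \<open>\<open>W\<close> holds the new vertices and \<open>R\<close> the surviving old ones. The
  \<open>k\<close> vertices of \<open>R\<close> have at most k d non-neighbours in total, so at most
  k d / 2 vertices miss two of them. As \<open>d\<close> is close to N/r, about (k - 2) N / (2 r)
  suitable vertices remain; half of this pays for the error in \<open>d\<close>.\<close>

lemma card_exchange_ge:
  assumes "W \<subseteq> V" "R \<subseteq> V" "card W \<le> r + 1 - k" "card R = k" "3 \<le> k" "k \<le> r + 1"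
  shows "card {x \<in> V. (\<forall>w\<in>W. adj w x) \<and> card {y \<in> R. \<not> adj y x} \<le> 1} \<ge> (real k - 2) / (4 * real r) * N"
proof -
  have r: "real r \<ge> 2"
    using r_ge by simp
  have fR: "finite R"
    using assms finite_V finite_subset by blast
  let ?bad = "{x \<in> V. card {y \<in> R. \<not> adj y x} \<ge> 2}"
  have "2 * card ?bad = (\<Sum>x\<in>?bad. 2)"
    by simp
  also have "\<dots> \<le> (\<Sum>x\<in>?bad. card {y \<in> R. \<not> adj y x})"
    by (rule sum_mono) auto
  also have "\<dots> \<le> (\<Sum>x\<in>V. card {y \<in> R. \<not> adj y x})"
    using finite_V by (intro sum_mono2) auto
  also have "\<dots> = (\<Sum>y\<in>R. card {x \<in> V. \<not> adj y x})"
    using finite_V fR by (intro sum_multicount_gen[where R = "\<lambda>x y. \<not> adj y x"]) auto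
  finally have "real (2 * card ?bad) \<le> real (\<Sum>y\<in>R. card {x \<in> V. \<not> adj y x})"
    by (rule of_nat_mono)
  then have "2 * real (card ?bad) \<le> (\<Sum>y\<in>R. real (card {x \<in> V. \<not> adj y x}))"
    by simp
  also have "\<dots> \<le> (\<Sum>y\<in>R. d)"
    using assms(2) nonadj_less by (intro sum_mono less_imp_le) auto
  finally have bad: "2 * real (card ?bad) \<le> k * d"
    using assms(4) by simp
  have "card {x \<in> V. \<forall>w\<in>W. adj w x} \<le>
      card ({x \<in> V. (\<forall>w\<in>W. adj w x) \<and> card {y \<in> R. \<not> adj y x} \<le> 1} \<union> ?bad)"
    using finite_V by (intro card_mono) auto
  also have "\<dots> \<le> card {x \<in> V. (\<forall>w\<in>W. adj w x) \<and> card {y \<in> R. \<not> adj y x} \<le> 1} + card ?bad"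
    by (rule card_Un_le)
  finally have "real (card {x \<in> V. \<forall>w\<in>W. adj w x}) \<le>
      real (card {x \<in> V. (\<forall>w\<in>W. adj w x) \<and> card {y \<in> R. \<not> adj y x} \<le> 1}) + card ?bad"
    by linarith
  moreover have "card W * d \<le> (real r + 1 - k) * d"
    using assms d_pos by (intro mult_right_mono) auto
  moreover have "N - (real r + 1 - k) * d - k * d / 2 \<ge> (real k - 2) / (4 * real r) * N"
  proof -
    have eq: "(N - (real r + 1 - k) * d - k * d / 2) - (real k - 2) / (4 * real r) * N =
        N * ((real k - 2) * real r ^ 3 - 4 * real r - 4 + 2 * k) / (4 * real r ^ 4)"
      unfolding d_def using r by (simp add: field_simps power_numeral_reduce)
    have "1 * real r ^ 3 \<le> (real k - 2) * real r ^ 3"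
      using assms(5) by (intro mult_right_mono) auto
    moreover have "4 * real r \<le> real r ^ 3"
      using power_mono[OF r, of 2] r by (simp add: power_numeral_reduce)
    moreover have "real k \<ge> 3"
      using assms(5) by simp
    ultimately have "(real k - 2) * real r ^ 3 - 4 * real r - 4 + 2 * k \<ge> 0"
      by linarith
    then have "N * ((real k - 2) * real r ^ 3 - 4 * real r - 4 + 2 * k) / (4 * real r ^ 4) \<ge> 0"
      using N_pos by (intro divide_nonneg_nonneg mult_nonneg_nonneg) auto
    then show ?thesis
      using eq by linarith
  qed
  ultimately show ?thesis
    using card_common_ge[OF assms(1)] bad by linarith
qed

text \<open>
  Starting from the clique \<open>K\<close>, its vertices are exchanged one at a time. Since only the pair of
  vertices of \<open>K\<close> that survives to the end matters, the pigeonhole principle is applied only once.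
\<close>

lemma exchange_lists:
  assumes K: "K \<subseteq> V" "card K = r + 1" "pairwise adj K"
    and "j \<le> r - 1"
  shows "real (card {ws. length ws = j \<and> set ws \<subseteq> V \<and> sorted_wrt adj ws \<and>
      (\<exists>R\<subseteq>K. card R = r + 1 - j \<and> (\<forall>x\<in>R. \<forall>w\<in>set ws. adj x w))})
    \<ge> (\<Prod>i<j. real (r - 1 - i) / (4 * real r)) * N ^ j"
    (is "real (card (?T j)) \<ge> _")
  using assms(4)
proof (induction j)
  case 0
  have "?T 0 = {[]}"
    using K(2) by auto
  then show ?case by simp
next
  case (Suc j)
  have fin: "finite (?T j)" for j
    by (rule finite_subset[OF _ finite_lists_length_eq[OF finite_V, of j]]) auto
  let ?a = "real (r - 1 - j) / (4 * real r) * N"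
  let ?X = "\<lambda>ws. {x \<in> V. x # ws \<in> ?T (Suc j)}"
  have "real (card (?T (Suc j))) \<ge> ?a * real (card (?T j))"
  proof (rule card_list_extensions_ge[where X = ?X and f = "(#)"])
    fix ws assume "ws \<in> ?T j"
    then obtain R where ws: "length ws = j" "set ws \<subseteq> V" "sorted_wrt adj ws"
      and R: "R \<subseteq> K" "card R = r + 1 - j" "\<And>x w. x \<in> R \<Longrightarrow> w \<in> set ws \<Longrightarrow> adj x w"
      by blast
    let ?k = "r + 1 - j"
    let ?Y = "{x \<in> V. (\<forall>w\<in>set ws. adj w x) \<and> card {y \<in> R. \<not> adj y x} \<le> 1}"
    have fR: "finite R"
      using R(1) K(1) finite_V finite_subset by meson
    have k: "3 \<le> ?k" "?k \<le> r + 1"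
      using Suc.prems r_ge by auto
    have "card (set ws) \<le> r + 1 - ?k"
      using card_length[of ws] ws(1) Suc.prems by simp
    then have 1: "(real ?k - 2) / (4 * real r) * N \<le> real (card ?Y)"
      using ws R K(1) k by (intro card_exchange_ge) auto
    have 2: "real ?k - 2 = real (r - 1 - j)"
      using Suc.prems r_ge by (simp add: of_nat_diff)
    have "?Y \<subseteq> ?X ws"
    proof
      fix x assume x: "x \<in> ?Y"
      \<comment> \<open>\<open>y\<close> is the vertex of \<open>R\<close> that \<open>x\<close>
        replaces: the only one not adjacent to \<open>x\<close>, or an arbitrary one if there is
        none, so that \<open>R\<close> shrinks by exactly one.\<close>
      obtain y where y: "y \<in> R" "{y \<in> R. \<not> adj y x} \<subseteq> {y}"
      proof (cases "{y \<in> R. \<not> adj y x} = {}")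
        case True
        have "R \<noteq> {}"
          using k R(2) by auto
        then show ?thesis using True that by blast
      next
        case False
        then obtain y where "y \<in> R" "\<not> adj y x"
          by blast
        moreover have "card {y \<in> R. \<not> adj y x} \<le> Suc 0"
          using x by simp
        ultimately have "{y \<in> R. \<not> adj y x} \<subseteq> {y}"
          using fR by (subst (asm) card_le_Suc0_iff_eq) auto
        then show ?thesis using \<open>y \<in> R\<close> that by blast
      qed
      have "card (R - {y}) = r + 1 - Suc j"
        using y R fR by simp
      moreover have "\<forall>z\<in>R - {y}. \<forall>w\<in>set (x # ws). adj z w"
        using y(2) R(3) by auto
      moreover have "R - {y} \<subseteq> K"
        using R by auto
      ultimately have "\<exists>R\<subseteq>K. card R = r + 1 - Suc j \<and> (\<forall>z\<in>R. \<forall>w\<in>set (x # ws). adj z w)"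
        by blast
      moreover have "sorted_wrt adj (x # ws)"
        using x ws(3) sym by auto
      ultimately show "x \<in> ?X ws"
        using x ws by simp
    qed
    then have "real (card ?Y) \<le> real (card (?X ws))"
      using finite_V by (intro of_nat_mono card_mono) auto
    with 1 show "real (card (?X ws)) \<ge> ?a"
      unfolding 2 by (rule order_trans)
  qed (use fin[of j] fin[of "Suc j"] finite_V in auto)
  moreover have "?a * real (card (?T j)) \<ge> ?a * ((\<Prod>i<j. real (r - 1 - i) / (4 * real r)) * N ^ j)"
    using Suc N_pos by (intro mult_left_mono) auto
  ultimately show ?case
    by (simp add: algebra_simps)
qed

text \<open>After r - 1 exchanges two vertices of \<open>K\<close> survive. A popular pair becomes
  \<open>u\<close>, \<open>v\<close>, and a common neighbour of the r - 1 new vertices is appended.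
  This last entry need not be adjacent to \<open>u\<close> or \<open>v\<close>, because it will
  belong to the same part as they do.\<close>

lemma joint_lists:
  assumes K: "K \<subseteq> V" "card K = r + 1" "pairwise adj K"
  obtains u v T where "u \<in> V" "v \<in> V" "adj u v"
    "\<And>l. l \<in> T \<Longrightarrow> length l = r \<and> set l \<subseteq> V \<and> sorted_wrt adj l \<and>
       (\<forall>w\<in>set (butlast l). adj u w \<and> adj v w)"
    "real (card T) \<ge> N ^ r / real r ^ (r + 7)"
proof -
  have r: "real r \<ge> 2"
    using r_ge by simp
  have fK: "finite K"
    using K(1) finite_V finite_subset by blast
  define S where "S R = {ws. length ws = r - 1 \<and> set ws \<subseteq> V \<and> sorted_wrt adj ws \<and>
      (\<forall>x\<in>R. \<forall>w\<in>set ws. adj x w)}" for R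
  define P where "P = {R. R \<subseteq> K \<and> card R = 2}"
  have fS: "finite (S R)" for R
    by (rule finite_subset[OF _ finite_lists_length_eq[OF finite_V, of "r - 1"]]) (auto simp: S_def)
  have cP: "card P = (r + 1) choose 2" and fP: "finite P"
    using n_subsets[OF fK, of 2] K(2) fK by (auto simp: P_def)
  have P0: "real (card P) = real r * (real r + 1) / 2"
    using r_ge unfolding cP by (simp add: choose_two real_of_nat_div algebra_simps)
  have eq: "{ws. length ws = r - 1 \<and> set ws \<subseteq> V \<and> sorted_wrt adj ws \<and>
      (\<exists>R\<subseteq>K. card R = r + 1 - (r - 1) \<and> (\<forall>x\<in>R. \<forall>w\<in>set ws. adj x w))} = (\<Union>R\<in>P. S R)"
    using r_ge by (auto simp: S_def P_def)
  have "(\<Prod>i<r - 1. real (r - 1 - i) / (4 * real r)) = fact (r - 1) / (4 * real r) ^ (r - 1)"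
    by (simp only: prod_dividef prod_constant card_lessThan prod_rev_fact)
  also have "\<dots> \<ge> (4 ^ (r - 1) / 16) / (4 * real r) ^ (r - 1)"
  proof (rule divide_right_mono)
    have "real (4 ^ (r - 1)) \<le> real (16 * fact (r - 1))"
      using four_power_le_fact of_nat_mono by blast
    then show "4 ^ (r - 1) / 16 \<le> (fact (r - 1) :: real)"
      by simp
  qed simp
  also have "(4 ^ (r - 1) / 16) / (4 * real r) ^ (r - 1) = 1 / (16 * real r ^ (r - 1))"
    using r by (simp add: power_mult_distrib)
  finally have "1 / (16 * real r ^ (r - 1)) * N ^ (r - 1)
      \<le> (\<Prod>i<r - 1. real (r - 1 - i) / (4 * real r)) * N ^ (r - 1)"
    using N_pos by (intro mult_right_mono) auto
  also have "\<dots> \<le> real (card (\<Union>R\<in>P. S R))"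
    using exchange_lists[OF K, of "r - 1"] unfolding eq by simp
  also have "\<dots> \<le> (\<Sum>R\<in>P. real (card (S R)))"
    using fP by (rule real_card_UN_le)
  finally have sum: "N ^ (r - 1) / (16 * real r ^ (r - 1)) \<le> (\<Sum>R\<in>P. real (card (S R)))"
    by simp
  define b where "b = N ^ (r - 1) / (16 * real r ^ (r - 1)) / real (card P)"
  have "\<exists>R\<in>P. real (card (S R)) \<ge> b"
  proof (rule ccontr)
    assume "\<not> ?thesis"
    then have "\<And>R. R \<in> P \<Longrightarrow> real (card (S R)) < b"
      by auto
    moreover have "P \<noteq> {}"
      using P0 r by auto
    ultimately have "(\<Sum>R\<in>P. real (card (S R))) < (\<Sum>R\<in>P. b)"
      using fP by (intro sum_strict_mono) auto
    also have "\<dots> = N ^ (r - 1) / (16 * real r ^ (r - 1))"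
      using \<open>P \<noteq> {}\<close> fP by (simp add: b_def)
    finally show False
      using sum by simp
  qed
  then obtain R where R: "R \<in> P" "real (card (S R)) \<ge> b"
    by blast
  then obtain u v where uv: "R = {u, v}" "u \<noteq> v"
    by (auto simp: P_def card_2_iff)
  then have uvK: "u \<in> K" "v \<in> K" "adj u v"
    using R K by (auto simp: P_def pairwise_def)
  define T where "T = {l. length l = r \<and> set l \<subseteq> V \<and> sorted_wrt adj l \<and>
       (\<forall>w\<in>set (butlast l). adj u w \<and> adj v w)}"
  have fT: "finite T"
    by (rule finite_subset[OF _ finite_lists_length_eq[OF finite_V, of r]]) (auto simp: T_def)
  have "real (card T) \<ge> N / (2 * real r) * real (card (S R))"
  proof (rule card_list_extensions_ge[where f = "\<lambda>x l. l @ [x]" and X = "\<lambda>l. {x \<in> V. \<forall>w\<in>set l. adj w x}"])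
    fix l assume l: "l \<in> S R"
    have "card (set l) < r"
      using card_length[of l] l r_ge by (auto simp: S_def)
    then show "N / (2 * real r) \<le> real (card {x \<in> V. \<forall>w\<in>set l. adj w x})"
      using card_common_ge[of "set l"] common_of_few_pos[of "card (set l)"] l by (auto simp: S_def)
  next
    fix l x assume "l \<in> S R" "x \<in> {x \<in> V. \<forall>w\<in>set l. adj w x}"
    then show "l @ [x] \<in> T"
      using r_ge uv by (auto simp: S_def T_def sorted_wrt_append)
  qed (use fT fS finite_V in auto)
  moreover have "N / (2 * real r) * real (card (S R)) \<ge> N / (2 * real r) * b"
    using R N_pos r by (intro mult_left_mono) auto
  moreover have "N / (2 * real r) * b \<ge> N ^ r / real r ^ (r + 7)"
  proof -
    obtain k where k: "r = Suc k"
      using r_ge by (cases r) auto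
    \<comment> \<open>The factors 16 r^(r-1) from the exchanges, r (r + 1) / 2 from the choice of
      the pair and 2 r from the appended vertex multiply to 16 (r + 1) r^(r+1); bounding 16 (r + 1)
      by r^6 produces the exponent r + 7.\<close>
    have eq: "N / (2 * real r) * b = N ^ r / (real r ^ (r + 1) * (16 * (real r + 1)))"
      unfolding b_def P0 using r k by (simp add: field_simps)
    have "16 * (real r + 1) \<le> real r ^ 6"
    proof -
      have "real r ^ 6 = real r ^ 5 * real r"
        by (simp add: power_numeral_reduce)
      moreover have "real r ^ 5 \<ge> 2 ^ 5"
        using r by (intro power_mono) auto
      then have "real r ^ 5 * real r \<ge> 2 ^ 5 * real r"
        using r by (intro mult_right_mono) auto
      moreover have "16 * (real r + 1) \<le> 2 ^ 5 * real r"
        using r by simp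
      ultimately show ?thesis
        by linarith
    qed
    then have "real r ^ (r + 1) * (16 * (real r + 1)) \<le> real r ^ (r + 1) * real r ^ 6"
      using r by (intro mult_left_mono) auto
    also have "\<dots> = real r ^ (r + 7)"
      by (simp only: power_add[symmetric] add.assoc) simp
    finally have "N ^ r / real r ^ (r + 7) \<le> N ^ r / (real r ^ (r + 1) * (16 * (real r + 1)))"
      using r N_pos by (intro divide_left_mono mult_pos_pos) auto
    then show ?thesis using eq by simp
  qed
  ultimately have "real (card T) \<ge> N ^ r / real r ^ (r + 7)"
    by linarith
  then show ?thesis
    using that[of u v T] uvK K(1) by (auto simp: T_def)
qed

end

section \<open>Complete multipartite subgraphs from many cliques\<close>

text \<open>On average a vertex of \<open>V\<close> extends at least 2 s of the s B elements of
  \<open>L\<close>, so at least |V| / B vertices extend \<open>s\<close> or more. Each of these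
  selects an s-subset of \<open>L\<close>, and by the pigeonhole principle some subset is selected
  \<open>t\<close> times.\<close>

lemma many_common_extensions:
  fixes L :: "'b set" and V :: "'a set" and P :: "'b \<Rightarrow> 'a \<Rightarrow> bool"
  assumes "finite L" "finite V" "card L = s * B" "B > 0"
    and deg: "\<And>l. l \<in> L \<Longrightarrow> 2 * card V \<le> B * card {y \<in> V. P l y}"
    and "2 ^ card L * t * B \<le> card V"
  shows "\<exists>L' Y. L' \<subseteq> L \<and> card L' = s \<and> Y \<subseteq> V \<and> card Y = t \<and> (\<forall>l\<in>L'. \<forall>y\<in>Y. P l y)"
proof (cases "s = 0")
  case True
  have "t * 1 \<le> t * (2 ^ card L * B)"
    using assms(4) by (intro mult_left_mono) auto
  also have "\<dots> \<le> card V"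
    using assms(6) by (simp add: algebra_simps)
  finally obtain Y where "Y \<subseteq> V" "card Y = t"
    using obtain_subset_with_card_n by (metis mult.right_neutral)
  then show ?thesis
    using True by (intro exI[of _ "{}"] exI[of _ Y]) auto
next
  case False
  let ?deg = "\<lambda>y. card {l \<in> L. P l y}"
  define Y where "Y = {y \<in> V. ?deg y \<ge> s}"
  have "2 * card V * s * B = (\<Sum>l\<in>L. 2 * card V)"
    using assms(3) by simp
  also have "\<dots> \<le> (\<Sum>l\<in>L. B * card {y \<in> V. P l y})"
    by (rule sum_mono) (use deg in auto)
  also have "\<dots> = B * (\<Sum>l\<in>L. card {y \<in> V. P l y})"
    by (simp add: sum_distrib_left)
  also have "(\<Sum>l\<in>L. card {y \<in> V. P l y}) = (\<Sum>y\<in>V. ?deg y)"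
    using assms(1,2) by (intro sum_multicount_gen[where R = P]) auto
  finally have "2 * card V * s \<le> (\<Sum>y\<in>V. ?deg y)"
    using assms(4) by (simp add: algebra_simps)
  \<comment> \<open>A vertex outside \<open>Y\<close> contributes less than \<open>s\<close> and a
    vertex of \<open>Y\<close> at most \<open>card L\<close>, so at least half of the total 2 s |V|
    has to come from \<open>Y\<close>.\<close>
  also have "\<dots> \<le> (\<Sum>y\<in>V. s + (if y \<in> Y then card L else 0))"
    using assms(1) by (intro sum_mono) (auto simp: Y_def intro!: card_mono trans_le_add2)
  also have "\<dots> = card V * s + card Y * card L"
    using assms(2) by (simp add: sum.distrib sum.If_cases Y_def Int_def conj_commute)
  finally have "card V * s \<le> card Y * B * s"
    using assms(3) by (simp add: algebra_simps)
  then have VY: "card V \<le> card Y * B"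
    using False by simp
  have fY: "finite Y"
    using assms(2) by (simp add: Y_def)
  have "\<exists>g. \<forall>y\<in>Y. g y \<subseteq> {l \<in> L. P l y} \<and> card (g y) = s"
    by (rule bchoice) (auto simp: Y_def elim: obtain_subset_with_card_n)
  then obtain g where g: "\<And>y. y \<in> Y \<Longrightarrow> g y \<subseteq> {l \<in> L. P l y} \<and> card (g y) = s"
    by blast
  have "\<exists>L'\<in>Pow L. card {y \<in> Y. g y = L'} \<ge> t \<and> card L' = s"
  \<comment> \<open>For \<open>t = 0\<close> the class of a popular subset may be empty and then
    says nothing about its size, so an s-subset is taken directly.\<close>
  proof (cases "t = 0")
    case True
    then show ?thesis
      using obtain_subset_with_card_n[of s L] assms(3,4) by (metis Pow_iff le0 mult.right_neutral mult_le_mono2 Suc_leI One_nat_def)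
  next
    case t: False
    have "\<exists>L'\<in>Pow L. card {y \<in> Y. g y = L'} \<ge> t"
    proof (rule ccontr)
      assume "\<not> ?thesis"
      then have less: "\<And>L'. L' \<in> Pow L \<Longrightarrow> card {y \<in> Y. g y = L'} < t"
        by (meson not_le)
      have "Y = (\<Union>L'\<in>Pow L. {y \<in> Y. g y = L'})"
        using g by blast
      then have "card Y \<le> (\<Sum>L'\<in>Pow L. card {y \<in> Y. g y = L'})"
        using card_UN_le[of "Pow L" "\<lambda>L'. {y \<in> Y. g y = L'}"] assms(1) by simp
      also have "\<dots> < (\<Sum>L'\<in>Pow L. t)"
        using assms(1) less by (intro sum_strict_mono) auto
      also have "\<dots> = 2 ^ card L * t"
        using assms(1) by (simp add: card_Pow)
      finally have "card Y * B < 2 ^ card L * t * B"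
        using assms(4) by simp
      then show False
        using VY assms(6) by linarith
    qed
    then obtain L' where L': "L' \<in> Pow L" "card {y \<in> Y. g y = L'} \<ge> t"
      by blast
    then have "{y \<in> Y. g y = L'} \<noteq> {}"
      using t by (metis card.empty le_zero_eq)
    then have "card L' = s"
      using g by blast
    then show ?thesis
      using L' by blast
  qed
  then obtain L' where L': "L' \<subseteq> L" "card L' = s" "t \<le> card {y \<in> Y. g y = L'}"
    by blast
  obtain Z where Z: "Z \<subseteq> {y \<in> Y. g y = L'}" "card Z = t"
    using obtain_subset_with_card_n[OF L'(3)] by blast
  have "Z \<subseteq> V"
    using Z by (auto simp: Y_def)
  moreover have "\<forall>l\<in>L'. \<forall>y\<in>Z. P l y"
    using Z g by blast
  ultimately show ?thesis
    using L' Z by blast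
qed

text \<open>Averaging: lists with fewer than \<tau> |V| extensions at the head account for at most
  \<tau> |V|^(k+1) elements of \<open>T\<close>, and each other list for at most |V|.\<close>

lemma card_good_prefixes:
  fixes T :: "'a list set" and p \<tau> :: real
  assumes "finite V" and T: "\<And>l. l \<in> T \<Longrightarrow> length l = Suc k \<and> set l \<subseteq> V"
    and "real (card T) \<ge> p * real (card V) ^ Suc k"
    and "\<tau> \<ge> 0" "card V > 0"
  shows "real (card {l. length l = k \<and> set l \<subseteq> V \<and> real (card {y \<in> V. y # l \<in> T}) \<ge> \<tau> * real (card V)})
    \<ge> (p - \<tau>) * real (card V) ^ k" (is "real (card ?G) \<ge> _")
proof -
  let ?U = "{l. set l \<subseteq> V \<and> length l = k}"
  let ?X = "\<lambda>l. {y \<in> V. y # l \<in> T}"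
  let ?n = "real (card V)"
  have fU: "finite ?U" and cU: "card ?U = card V ^ k"
    using assms(1) finite_lists_length_eq card_lists_length_eq by blast+
  have "T \<subseteq> (\<lambda>(l, x). x # l) ` (SIGMA l:?U. ?X l)"
  proof
    fix l assume l: "l \<in> T"
    then obtain y l' where "l = y # l'"
      using T by (cases l) force+
    then show "l \<in> (\<lambda>(l, x). x # l) ` (SIGMA l:?U. ?X l)"
      using T[OF l] l by (intro image_eqI[of _ _ "(l', y)"]) auto
  qed
  then have "card T \<le> card ((\<lambda>(l, x). x # l) ` (SIGMA l:?U. ?X l))"
    using fU assms(1) by (intro card_mono) auto
  also have "\<dots> \<le> card (SIGMA l:?U. ?X l)"
    using fU assms(1) by (intro card_image_le) auto
  also have "\<dots> = (\<Sum>l\<in>?U. card (?X l))"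
    using fU assms(1) by (simp add: card_SigmaI)
  finally have "real (card T) \<le> real (\<Sum>l\<in>?U. card (?X l))"
    by (rule of_nat_mono)
  also have "\<dots> = (\<Sum>l\<in>?U. real (card (?X l)))"
    by simp
  also have "\<dots> \<le> (\<Sum>l\<in>?U. \<tau> * ?n + (if l \<in> ?G then ?n else 0))"
  proof (rule sum_mono)
    fix l assume "l \<in> ?U"
    moreover have "card (?X l) \<le> card V"
      using assms(1) by (intro card_mono) auto
    moreover have "\<tau> * ?n \<ge> 0"
      using assms(4) by simp
    ultimately show "real (card (?X l)) \<le> \<tau> * ?n + (if l \<in> ?G then ?n else 0)"
      by auto
  qed
  also have "\<dots> = real (card V ^ k) * (\<tau> * ?n) + real (card (?U \<inter> ?G)) * ?n"
    using fU cU by (simp add: sum.distrib sum.If_cases del: mem_Collect_eq)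
  also have "?U \<inter> ?G = ?G"
    by auto
  finally have "p * ?n ^ Suc k \<le> ?n ^ k * (\<tau> * ?n) + real (card ?G) * ?n"
    using assms(3) by simp
  then have "((p - \<tau>) * ?n ^ k) * ?n \<le> real (card ?G) * ?n"
    by (simp add: algebra_simps)
  then show ?thesis
    using assms(5) by simp
qed

text \<open>The lists are the rows of an array. For irreflexive \<open>adj\<close> its columns are
  the parts of a complete k-partite graph with all parts of size \<open>card L\<close>, while the
  rows record which vertices come from a common list.\<close>

definition matched :: "('a \<Rightarrow> 'a \<Rightarrow> bool) \<Rightarrow> nat \<Rightarrow> 'a list set \<Rightarrow> bool" where
  "matched adj k L \<longleftrightarrow> finite L \<and> (\<forall>a<k. inj_on (\<lambda>l. l ! a) L) \<and>
    (\<forall>l\<in>L. \<forall>l'\<in>L. \<forall>a<k. \<forall>b<k. a \<noteq> b \<longrightarrow> adj (l ! a) (l' ! b))"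

text \<open>
  Keeping the rows of the multipartite graph inside the set \<open>T\<close> of lists makes the induction go
  through: every row still has many extensions, so no hypergraph version is needed and the sizes
  of the parts stay logarithmic.
\<close>

lemma extend_matched:
  fixes adj :: "'a \<Rightarrow> 'a \<Rightarrow> bool" and V :: "'a set"
  assumes "finite V" "card V > 0" "B > 0"
    and T: "\<And>l. l \<in> T \<Longrightarrow> length l = Suc k \<and> set l \<subseteq> V \<and> sorted_wrt adj l"
    and cT: "real (card T) \<ge> real (Suc k) * (2 / real B) * real (card V) ^ Suc k"
    and t: "2 ^ (s * B) * t * B \<le> card V"
    and fam: "\<And>G. (\<And>l. l \<in> G \<Longrightarrow> length l = k \<and> set l \<subseteq> V \<and> sorted_wrt adj l) \<Longrightarrow>
      real (card G) \<ge> real k * (2 / real B) * real (card V) ^ k \<Longrightarrow>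
      \<exists>L\<subseteq>G. card L = s * B \<and> matched adj k L"
  obtains L Y where "card L = s" "matched adj k L" "Y \<subseteq> V" "card Y = t"
    "\<And>l y. l \<in> L \<Longrightarrow> y \<in> Y \<Longrightarrow> y # l \<in> T"
    "\<And>l. l \<in> L \<Longrightarrow> length l = k \<and> set l \<subseteq> V"
proof -
  let ?\<tau> = "2 / real B"
  let ?n = "real (card V)"
  define G where "G = {l. length l = k \<and> set l \<subseteq> V \<and> real (card {y \<in> V. y # l \<in> T}) \<ge> ?\<tau> * ?n}"
  \<comment> \<open>The density is measured in shares of 2 / B. The threshold for \<open>G\<close>
    uses up one of the k + 1 shares and leaves \<open>k\<close> for the next level.\<close>
  have "real (card G) \<ge> (real (Suc k) * ?\<tau> - ?\<tau>) * ?n ^ k"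
    unfolding G_def using assms(1-3) T cT by (intro card_good_prefixes) auto
  moreover have "real (Suc k) * ?\<tau> - ?\<tau> = real k * ?\<tau>"
    using assms(3) by (simp add: field_simps)
  ultimately have cG: "real (card G) \<ge> real k * ?\<tau> * ?n ^ k"
    by simp
  have \<tau>n: "?\<tau> * ?n > 0"
    using assms by simp
  \<comment> \<open>The threshold is positive, so a list in \<open>G\<close> has an extension in
    \<open>T\<close> and inherits the clique property from it.\<close>
  have G: "length l = k \<and> set l \<subseteq> V \<and> sorted_wrt adj l" if "l \<in> G" for l
  proof -
    have "card {y \<in> V. y # l \<in> T} \<noteq> 0"
      using that \<tau>n by (auto simp: G_def simp del: card_eq_0_iff card_0_eq)
    then have "{y \<in> V. y # l \<in> T} \<noteq> {}"
      by (metis card.empty)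
    then obtain y where "y # l \<in> T"
      by blast
    then show ?thesis
      using T[of "y # l"] that by (auto simp: G_def)
  qed
  obtain L where L: "L \<subseteq> G" "card L = s * B" "matched adj k L"
    using fam[OF G cG] by blast
  then have fL: "finite L"
    by (simp add: matched_def)
  have "\<exists>L' Y. L' \<subseteq> L \<and> card L' = s \<and> Y \<subseteq> V \<and> card Y = t \<and> (\<forall>l\<in>L'. \<forall>y\<in>Y. y # l \<in> T)"
  proof (rule many_common_extensions[OF fL assms(1) L(2) assms(3)])
    fix l assume "l \<in> L"
    then have "?\<tau> * ?n \<le> card {y \<in> V. y # l \<in> T}"
      using L(1) by (auto simp: G_def)
    then have "2 * ?n \<le> real (B * card {y \<in> V. y # l \<in> T})"
      using assms(3) by (simp add: field_simps)
    then show "2 * card V \<le> B * card {y \<in> V. y # l \<in> T}"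
      by linarith
  next
    show "2 ^ card L * t * B \<le> card V"
      using L(2) t by simp
  qed
  then obtain L' Y where L': "L' \<subseteq> L" "card L' = s" and Y: "Y \<subseteq> V" "card Y = t"
    and ext: "\<And>l y. l \<in> L' \<Longrightarrow> y \<in> Y \<Longrightarrow> y # l \<in> T"
    by blast
  have "matched adj k L'"
    using L(3) L'(1) fL unfolding matched_def
    by (meson finite_subset inj_on_subset subsetD)
  moreover have "length l = k \<and> set l \<subseteq> V" if "l \<in> L'" for l
    using that L'(1) L(1) G by blast
  ultimately show ?thesis
    using that[OF L'(2) _ Y ext] by blast
qed

text \<open>Each level asks the level below for s B rows, of which \<open>extend_matched\<close>
  keeps \<open>s\<close>; over k - 1 levels this grows to s B^(k-1), which dictates the size
  condition. Taking as many new vertices as rows allows one to be put in front of each row.\<close>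

lemma matched_family:
  fixes adj :: "'a \<Rightarrow> 'a \<Rightarrow> bool" and V :: "'a set"
  assumes "finite V" "card V > 0" "B > 0" and sym: "\<And>x y. adj x y \<Longrightarrow> adj y x"
    and "k \<ge> 1"
    and "\<And>l. l \<in> T \<Longrightarrow> length l = k \<and> set l \<subseteq> V \<and> sorted_wrt adj l"
    and "real (card T) \<ge> real k * (2 / real B) * real (card V) ^ k"
    and "2 ^ (s * B ^ (k - 1)) * (s * B ^ (k - 1)) * B \<le> card V"
  shows "\<exists>L\<subseteq>T. card L = s \<and> matched adj k L"
  using assms(5-8)
proof (induction k arbitrary: T s rule: nat_induct_at_least)
  case base
  have s: "2 ^ s * s * B \<le> card V"
    using base.prems(3) by simp
  have "1 * (s * B) \<le> 2 ^ s * (s * B)"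
    by (intro mult_right_mono) auto
  then have "s * B \<le> card V"
    using s by (simp only: mult.assoc mult_1)
  then have "real s * B \<le> card V"
    by (metis of_nat_mono of_nat_mult)
  then have "real s \<le> card V / B"
    using assms(3) by (simp add: field_simps)
  also have "\<dots> \<le> 2 / real B * card V"
    using assms(2,3) by (simp add: field_simps)
  also have "\<dots> \<le> card T"
    using base.prems(2) by simp
  finally have "s \<le> card T"
    by simp
  then obtain L where L: "L \<subseteq> T" "card L = s" "finite L"
    using obtain_subset_with_card_n by blast
  have "inj_on (\<lambda>l. l ! 0) L"
  proof (rule inj_onI)
    fix l l' assume l: "l \<in> L" "l' \<in> L" "l ! 0 = l' ! 0"
    then have "l \<in> T" "l' \<in> T"
      using L(1) by auto
    with l show "l = l'"
      using base.prems(1)[of l] base.prems(1)[of l'] by (intro nth_equalityI) auto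
  qed
  then show ?case
    using L by (intro exI[of _ L]) (auto simp: matched_def)
next
  case (Suc k)
  have pow: "s * B * B ^ (k - 1) = s * B ^ (Suc k - 1)"
    using Suc.hyps by (cases k) auto
  have 1: "s * B \<le> s * B ^ k"
    using self_le_power[of B k] Suc.hyps assms(3) by (intro mult_left_mono) auto
  have 2: "s \<le> s * B ^ k"
    using assms(3) by simp
  have "2 ^ (s * B) * s * B \<le> 2 ^ (s * B ^ k) * (s * B ^ k) * B"
    by (rule mult_le_mono1[OF mult_le_mono[OF power_increasing[OF 1] 2]]) simp
  also have "\<dots> \<le> card V"
    using Suc.prems(3) by simp
  finally have small: "2 ^ (s * B) * s * B \<le> card V" .
  obtain L' Y where L': "card L' = s" "matched adj k L'" and Y: "Y \<subseteq> V" "card Y = s"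
    and ext: "\<And>l y. l \<in> L' \<Longrightarrow> y \<in> Y \<Longrightarrow> y # l \<in> T"
    and len: "\<And>l. l \<in> L' \<Longrightarrow> length l = k \<and> set l \<subseteq> V"
  proof (rule extend_matched[OF assms(1-3) _ Suc.prems(2) small])
    show "length l = Suc k \<and> set l \<subseteq> V \<and> sorted_wrt adj l" if "l \<in> T" for l
      using Suc.prems(1) that .
    show "\<exists>L\<subseteq>G. card L = s * B \<and> matched adj k L"
      if "\<And>l. l \<in> G \<Longrightarrow> length l = k \<and> set l \<subseteq> V \<and> sorted_wrt adj l"
        "real (card G) \<ge> real k * (2 / real B) * real (card V) ^ k" for G
      using Suc.IH[OF that, of "s * B"] Suc.prems(3) by (simp only: pow)
  qed (rule that)
  have fin: "finite L'" "finite Y"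
    using L'(2) Y(1) assms(1) finite_subset by (auto simp: matched_def)
  then obtain h where h: "bij_betw h L' Y"
    using finite_same_card_bij L'(1) Y(2) by metis
  have hY: "h l \<in> Y" if "l \<in> L'" for l
    using h that by (auto simp: bij_betw_def)
  \<comment> \<open>Every vertex of \<open>Y\<close> extends every row, so \<open>h l # l'\<close>
    is in \<open>T\<close> for any two rows. Hence the new column is adjacent to the old ones across
    rows as well.\<close>
  have adj: "adj (h l) (l' ! b)" if "l \<in> L'" "l' \<in> L'" "b < k" for l l' b
    using Suc.prems(1)[OF ext[of l' "h l"]] hY that len by auto
  let ?L = "(\<lambda>l. h l # l) ` L'"
  show ?case
    unfolding matched_def
  proof (intro exI[of _ ?L] conjI allI impI ballI)
    show "?L \<subseteq> T"
      using ext hY by auto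
    show "card ?L = s"
      using L'(1) by (subst card_image) (auto simp: inj_on_def)
    show "finite ?L"
      using fin by simp
  next
    fix a assume a: "a < Suc k"
    show "inj_on (\<lambda>l. l ! a) ?L"
    proof (cases a)
      case 0
      then show ?thesis
        using h by (auto simp: inj_on_def bij_betw_def)
    next
      case (Suc a')
      then have "inj_on (\<lambda>l. l ! a') L'"
        using L'(2) a by (simp add: matched_def)
      then show ?thesis
        using Suc by (auto simp: inj_on_def)
    qed
  next
    fix m m' a b assume m: "m \<in> ?L" "m' \<in> ?L" and ab: "a < Suc k" "b < Suc k" "a \<noteq> b"
    then obtain l l' where l: "m = h l # l" "l \<in> L'" "m' = h l' # l'" "l' \<in> L'"
      by blast
    show "adj (m ! a) (m' ! b)"
    proof (cases a)
      case 0
      then show ?thesis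
        using adj[of l l' "b - 1"] l ab by (cases b) auto
    next
      case (Suc a')
      then show ?thesis
        using adj[of l' l a'] l ab L'(2) sym by (cases b) (auto simp: matched_def)
    qed
  qed
qed

section \<open>Embedding the forbidden graph\<close>

text \<open>A vertex in two parts would give a loop, so the parts are disjoint and bijections onto
  them glue to an injection. The bijection for the first part has to send 0 and 1 to
  \<open>u\<close> and \<open>v\<close>, the ends of the additional edge.\<close>

lemma K_plus_embedding:
  fixes P :: "nat \<Rightarrow> 'a set"
  assumes G: "simple_graph G" and "s \<noteq> []"
    and P: "\<And>i. i < length s \<Longrightarrow> P i \<subseteq> verts G" "\<And>i. i < length s \<Longrightarrow> card (P i) = s ! i"
    and cross: "\<And>i j x y. i < length s \<Longrightarrow> j < length s \<Longrightarrow> i \<noteq> j \<Longrightarrow> x \<in> P i \<Longrightarrow> y \<in> P j \<Longrightarrow>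
      {x, y} \<in> edges G"
    and uv: "u \<in> P 0" "v \<in> P 0" "{u, v} \<in> edges G"
  shows "\<exists>H. subgraph H G \<and> isomorphic (K_plus s) H"
proof -
  have loopless: "{x} \<notin> edges G" for x
    using G by (auto simp: simple_graph_def nsets_def)
  then have "u \<noteq> v"
    using uv(3) by auto
  have fP: "finite (P i)" if "i < length s" for i
    using P(1)[OF that] G finite_subset by (auto simp: simple_graph_def)
  have "\<exists>h. bij_betw h {..<s ! i} (P i) \<and> (i = 0 \<longrightarrow> h 0 = u \<and> h 1 = v)" if i: "i < length s" for i
  proof (cases "i = 0")
    case False
    then show ?thesis
      using ex_bij_betw_nat_finite[OF fP[OF i]] P(2)[OF i] by (auto simp: atLeast0LessThan)
  next
    case True
    have c: "card (P 0 - {u, v}) = s ! 0 - 2"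
      using uv \<open>u \<noteq> v\<close> P(2)[of 0] i True by (subst card_Diff_subset) auto
    have "2 \<le> s ! 0"
      using card_mono[of "P 0" "{u, v}"] fP[of 0] uv \<open>u \<noteq> v\<close> P(2)[of 0] i True by auto
    have "card {2..<s ! 0} = card (P 0 - {u, v})"
      using c by simp
    then obtain g where g: "bij_betw g {2..<s ! 0} (P 0 - {u, v})"
      using finite_same_card_bij[of "{2..<s ! 0}" "P 0 - {u, v}"] fP[of 0] i True by auto
    define h where "h j = (if j = 0 then u else if j = 1 then v else g j)" for j :: nat
    have "bij_betw h {2..<s ! 0} (P 0 - {u, v})"
      using g by (subst bij_betw_cong[of _ _ g]) (auto simp: h_def)
    moreover have "bij_betw h {0, 1} {u, v}"
      using \<open>u \<noteq> v\<close> by (auto simp: h_def bij_betw_def)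
    ultimately have "bij_betw h ({2..<s ! 0} \<union> {0, 1}) ((P 0 - {u, v}) \<union> {u, v})"
      by (rule bij_betw_combine) auto
    moreover have "{2..<s ! 0} \<union> {0, 1} = {..<s ! 0}"
      using \<open>2 \<le> s ! 0\<close> by auto
    moreover have "(P 0 - {u, v}) \<union> {u, v} = P 0"
      using uv by auto
    ultimately show ?thesis
      using True by (intro exI[of _ h]) (auto simp: h_def)
  qed
  then obtain h where h: "\<And>i. i < length s \<Longrightarrow> bij_betw (h i) {..<s ! i} (P i)"
    and h0: "h 0 0 = u" "h 0 1 = v"
    using \<open>s \<noteq> []\<close> by (metis length_greater_0_conv)
  define f where "f = (\<lambda>(i, j). h i j)"
  let ?V = "{(i, j). i < length s \<and> j < s ! i}"
  have fV: "f (i, j) \<in> P i" if "(i, j) \<in> ?V" for i j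
    using h that by (auto simp: f_def bij_betw_def)
  have inj: "inj_on f ?V"
  proof (rule inj_onI)
    fix p q assume p: "p \<in> ?V" and q: "q \<in> ?V" and eq: "f p = f q"
    obtain i j k l where pq: "p = (i, j)" "q = (k, l)"
      by (metis surj_pair)
    have "i = k"
      using cross[of i k "f p" "f q"] fV[of i j] fV[of k l] p q eq loopless pq by auto
    then show "p = q"
      using h[of i] p q eq pq by (auto simp: f_def bij_betw_def inj_on_def)
  qed
  define H where "H = (f ` ?V, (\<lambda>e. f ` e) ` edges (K_plus s))"
  have vK: "verts (K_plus s) = ?V"
    by (simp add: K_plus_def Let_def)
  have VH: "verts H \<subseteq> verts G"
    using fV P(1) by (fastforce simp: H_def)
  have EH: "edges H \<subseteq> edges G"
  proof
    fix e assume "e \<in> edges H"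
    then consider p q where "p \<in> ?V" "q \<in> ?V" "fst p \<noteq> fst q" "e = f ` {p, q}" | "e = f ` {(0, 0), (0, 1)}"
      by (auto simp: H_def K_plus_def Let_def)
    then show "e \<in> edges G"
    proof cases
      case 1
      then show ?thesis
        using cross[of "fst p" "fst q" "f p" "f q"] fV[of "fst p" "snd p"] fV[of "fst q" "snd q"] by auto
    next
      case 2
      then show ?thesis
        using uv h0 by (simp add: f_def)
    qed
  qed
  have u2: "2 \<le> s ! 0"
    using card_mono[of "P 0" "{u, v}"] fP[of 0] uv \<open>u \<noteq> v\<close> P(2)[of 0] \<open>s \<noteq> []\<close> by auto
  have "edges (K_plus s) \<subseteq> Pow ?V"
    using u2 \<open>s \<noteq> []\<close> by (auto simp: K_plus_def Let_def)
  then have "e \<subseteq> verts H" if "e \<in> edges H" for e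
    using that by (auto simp: H_def)
  moreover have "finite (verts H)"
    using VH G finite_subset by (auto simp: simple_graph_def)
  moreover have "card e = 2 \<and> finite e" if "e \<in> edges H" for e
    using that EH G by (auto simp: simple_graph_def nsets_def)
  ultimately have "simple_graph H"
    by (auto simp: simple_graph_def nsets_def)
  then have "subgraph H G"
    using VH EH by (simp add: subgraph_def)
  moreover have "isomorphic (K_plus s) H"
    unfolding isomorphic_def using inj vK by (intro exI[of _ f]) (auto simp: H_def bij_betw_def)
  ultimately show ?thesis
    by blast
qed

text \<open>Provides the size conditions of \<open>K_plus_if_dense_clique\<close> for a vertex set
  smaller than \<open>n\<close> by at most a factor r^4. The upper bound on \<open>c\<close> gives c
  B^2 \<le> 1 and c B^(r-1) \<le> 1/4. With L = ln n and c L \<ge> 2 the former yields L \<ge> 2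
  B^2, so exponentials in L absorb the constants.\<close>

lemma parameter_bounds:
  fixes r n :: nat and c :: real
  defines "B \<equiv> 2 * r ^ (r + 8)"
  defines "s \<equiv> nat \<lfloor>c * ln (real n)\<rfloor>" and "t \<equiv> nat \<lceil>real n powr (1 - 2 * sqrt c)\<rceil>"
  assumes r: "r \<ge> 2" and n: "n \<ge> 2" and c1: "2 / ln (real n) \<le> c"
    and c2: "c \<le> real r powi (- int ((r + 7) * (r + 1))) / 2"
  shows "s \<ge> 2" and "n \<ge> B ^ 2"
    and "n \<le> N * r ^ 4 \<Longrightarrow> 2 ^ (s * B ^ (r - 1)) * (s * B ^ (r - 1)) * B \<le> N"
    and "n \<le> N * r ^ 4 \<Longrightarrow> 2 ^ (s * B) * t * B \<le> N"
proof -
  define q where "q = real r ^ ((r + 7) * (r + 1))"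
  define L where "L = ln (real n)"
  have rr: "real r \<ge> 2"
    using r by simp
  have "q > 0"
    using rr by (simp add: q_def)
  have L: "L > 0"
    using n by (simp add: L_def)
  have c0: "c > 0"
    using c1 L unfolding L_def by (smt (verit) divide_pos_pos)
  have cL: "c * L \<ge> 2"
    using c1 L by (simp add: L_def field_simps)
  have c2': "c * (2 * q) \<le> 1"
  proof -
    have "c \<le> inverse q / 2"
      using c2 unfolding q_def power_int_minus power_int_of_nat .
    then show ?thesis
      using \<open>q > 0\<close> by (simp add: field_simps)
  qed
  have B: "real B = 2 * real r ^ (r + 8)"
    by (simp add: B_def)
  have Bsq: "real B ^ 2 \<le> 2 * q"
  proof -
    have "real B ^ 2 = 2 * (2 * real r ^ (2 * r + 16))"
      by (simp add: B power_mult_distrib mult.commute[of r] flip: power_mult)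
    also have "\<dots> \<le> 2 * (real r * real r ^ (2 * r + 16))"
      using rr by (intro mult_left_mono mult_right_mono) auto
    also have "\<dots> = 2 * real r ^ (2 * r + 17)"
      by (simp add: add.commute[of _ "2 * r"] flip: power_Suc)
    also have "\<dots> \<le> 2 * real r ^ ((r + 7) * (r + 1))"
      using rr r by (intro mult_left_mono power_increasing) (auto simp: algebra_simps)
    finally show ?thesis by (simp add: q_def)
  qed
  have Bpow: "4 * real B ^ (r - 1) \<le> 2 * q"
  proof -
    have "4 * real B ^ (r - 1) = 2 * (2 * 2 ^ (r - 1) * real r ^ ((r + 8) * (r - 1)))"
      by (simp add: B power_mult_distrib flip: power_mult)
    also have "2 * 2 ^ (r - 1) = (2::real) ^ r"
      using r by (cases r) auto
    also have "2 * (2 ^ r * real r ^ ((r + 8) * (r - 1))) \<le> 2 * (real r ^ r * real r ^ ((r + 8) * (r - 1)))"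
      using rr by (intro mult_left_mono mult_right_mono power_mono) auto
    also have "\<dots> = 2 * real r ^ (r + (r + 8) * (r - 1))"
      by (simp only: power_add)
    also have "\<dots> \<le> 2 * real r ^ ((r + 7) * (r + 1))"
    proof -
      obtain k where "r = Suc k"
        using r by (cases r) auto
      then have "r + (r + 8) * (r - 1) \<le> (r + 7) * (r + 1)"
        by (simp add: algebra_simps)
      then show ?thesis
        using rr by (intro mult_left_mono power_increasing) auto
    qed
    finally show ?thesis by (simp add: q_def)
  qed
  have cB2: "c * real B ^ 2 \<le> 1"
    using mult_left_mono[OF Bsq, of c] c0 c2' by linarith
  have cBp: "c * real B ^ (r - 1) \<le> 1 / 4"
    using mult_left_mono[OF Bpow, of c] c0 c2' by linarith
  have Br: "real B \<ge> 2 * real r ^ 4" and Bge: "real B \<ge> 2"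
  proof -
    show "real B \<ge> 2 * real r ^ 4"
      unfolding B using rr by (intro mult_left_mono power_increasing) auto
    moreover have "real r ^ 4 \<ge> 1"
      using rr by (intro one_le_power) auto
    ultimately show "real B \<ge> 2"
      by linarith
  qed
  have Brr: "2 * real B * real r ^ 4 \<le> real B ^ 2"
    using mult_left_mono[OF Br, of "real B"] by (simp add: power2_eq_square algebra_simps)
  have LB: "L \<ge> 2 * real B ^ 2"
  proof -
    have "c * (2 * real B ^ 2) \<le> c * L"
      using cB2 cL by linarith
    then show ?thesis
      using c0 by simp
  qed
  have nL: "real n = exp L"
    using n by (simp add: L_def)
  have expge: "exp x \<ge> x" for x :: real
    using exp_ge_add_one_self[of x] by linarith
  have sL: "real s \<le> c * L"
    using cL unfolding s_def L_def by simp
  show "s \<ge> 2"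
    using cL unfolding s_def L_def by linarith
  have "real B ^ 2 \<le> exp L"
    using LB expge[of L] by (smt (verit) zero_le_power2)
  then show "n \<ge> B ^ 2"
    using nL by (metis of_nat_le_iff of_nat_power)
  have two: "2 ^ m \<le> exp (real m)" for m
  proof -
    have "(2::real) ^ m \<le> exp 1 ^ m"
      using exp_ge_add_one_self[of 1] by (intro power_mono) auto
    then show ?thesis
      by (simp flip: exp_of_nat_mult)
  qed
  {
    assume N: "n \<le> N * r ^ 4"
    have N': "exp L \<le> real N * real r ^ 4"
      using N nL by (metis of_nat_mono of_nat_mult of_nat_power)
    have r4: "real r ^ 4 > 0"
      using rr by simp
    \<comment> \<open>As m \<le> L / 4, one factor exp (L / 2) pays for \<open>2 ^ m * m\<close> and
      another one for \<open>B * r ^ 4\<close>.\<close>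
    define m where "m = s * B ^ (r - 1)"
    have "real m \<le> c * L * real B ^ (r - 1)"
      unfolding m_def using sL by (simp add: mult_right_mono)
    also have "\<dots> \<le> L / 4"
      using mult_right_mono[OF cBp, of L] L by (simp add: algebra_simps)
    finally have m: "real m \<le> L / 4" .
    have "real (2 ^ m * m) \<le> exp (real m) * exp (real m)"
      using two[of m] expge[of "real m"] by (simp add: mult_mono)
    also have "\<dots> = exp (2 * real m)"
      by (simp flip: exp_add)
    also have "\<dots> \<le> exp (L / 2)"
      using m by simp
    finally have 1: "real (2 ^ m * m) \<le> exp (L / 2)" .
    have "real B * real r ^ 4 \<le> L / 2"
      using Brr LB zero_le_power2[of "real B"] by linarith
    then have "real B * real r ^ 4 \<le> exp (L / 2)"
      using expge[of "L / 2"] by linarith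
    then have "real (2 ^ m * m) * (real B * real r ^ 4) \<le> exp (L / 2) * exp (L / 2)"
      using 1 by (intro mult_mono) auto
    also have "\<dots> = exp L"
      by (simp flip: exp_add)
    finally have "real (2 ^ m * m * B) * real r ^ 4 \<le> real N * real r ^ 4"
      using N' by (simp add: algebra_simps)
    then have "real (2 ^ m * m * B) \<le> real N"
      using r4 by (simp only: mult_le_cancel_right_pos)
    then show "2 ^ (s * B ^ (r - 1)) * (s * B ^ (r - 1)) * B \<le> N"
      unfolding m_def by (simp only: of_nat_le_iff)
    \<comment> \<open>The exponent 1 - 2 sqrt c leaves two factors exp (w L) to spend: w B \<le> 1
      implies s B \<le> w L, so one covers \<open>2 ^ (s * B)\<close>, and the other covers
      \<open>2 * B * r ^ 4\<close>.\<close>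
    define w where "w = sqrt c"
    have w: "w > 0" "w * w = c"
      using c0 by (auto simp: w_def)
    have wB: "w * real B \<le> 1"
    proof -
      have "(w * real B) ^ 2 \<le> 1 ^ 2"
        using cB2 unfolding power_mult_distrib power2_eq_square[of w] w(2) by simp
      then show ?thesis
        by (rule power2_le_imp_le) simp
    qed
    have "w * 2 \<le> w * real B"
      using w Bge by (intro mult_left_mono) auto
    then have w2: "1 - 2 * w \<ge> 0"
      using wB by linarith
    have "real (s * B) \<le> c * L * real B"
      using sL by (simp add: mult_right_mono)
    also have "\<dots> = (w * L) * (w * real B)"
      using w(2) by (simp add: algebra_simps flip: w(2))
    also have "\<dots> \<le> (w * L) * 1"
      using wB w L by (intro mult_left_mono) auto
    finally have sB: "real (s * B) \<le> w * L" by simp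
    have "w * (w * L) \<ge> 2"
      using cL w(2) by (simp flip: mult.assoc)
    then have "w * (w * L) \<ge> w * (2 * real B)"
      using wB by linarith
    then have wL: "w * L \<ge> 2 * real B"
      using w by simp
    have "2 * real B * real r ^ 4 \<le> real B * real B"
      using Brr by (simp add: power2_eq_square)
    also have "\<dots> \<le> exp (real B) * exp (real B)"
      using expge by (intro mult_mono) auto
    also have "\<dots> = exp (2 * real B)"
      by (simp flip: exp_add)
    also have "\<dots> \<le> exp (w * L)"
      using wL by simp
    finally have 2: "2 * real B * real r ^ 4 \<le> exp (w * L)" .
    have "(2::real) ^ (s * B) \<le> exp (w * L)"
      using two[of "s * B"] sB order_trans exp_le_cancel_iff by blast
    then have "real (2 ^ (s * B)) \<le> exp (w * L)"
      by simp
    \<comment> \<open>Since 1 - 2 w is nonnegative, the power is at least 1 and rounding it up at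
      most doubles it.\<close>
    moreover have t: "real t \<le> 2 * exp (L - 2 * w * L)"
    proof -
      have pw: "real n powr (1 - 2 * w) = exp (L - 2 * w * L)"
        using n by (simp add: powr_def L_def algebra_simps)
      have "L - 2 * w * L = (1 - 2 * w) * L"
        by (simp add: algebra_simps)
      then have "1 \<le> exp (L - 2 * w * L)"
        using w2 L by simp
      moreover have "real t \<le> real n powr (1 - 2 * w) + 1"
        unfolding t_def w_def[symmetric] by (smt (verit) of_nat_nat of_int_ceiling_le_add_one powr_ge_zero ceiling_mono ceiling_zero)
      ultimately show ?thesis
        unfolding pw by linarith
    qed
    ultimately have "real (2 ^ (s * B)) * real t * (2 * real B * real r ^ 4)
        \<le> exp (w * L) * (2 * exp (L - 2 * w * L)) * exp (w * L)"
      using 2 by (intro mult_mono) auto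
    also have "\<dots> = 2 * (exp (w * L) * exp (L - 2 * w * L) * exp (w * L))"
      by simp
    also have "exp (w * L) * exp (L - 2 * w * L) * exp (w * L) = exp L"
      by (simp flip: exp_add)
    finally have "real (2 ^ (s * B) * t * B) * real r ^ 4 \<le> real N * real r ^ 4"
      using N' by (simp add: algebra_simps)
    then have "real (2 ^ (s * B) * t * B) \<le> real N"
      using r4 by (simp only: mult_le_cancel_right_pos)
    then show "2 ^ (s * B) * t * B \<le> N"
      by (simp only: of_nat_le_iff)
  }
qed

section \<open>Excess over the Turan bound\<close>

lemma dense_graphI:
  fixes adj :: "'a \<Rightarrow> 'a \<Rightarrow> bool"
  assumes "finite W" "W \<noteq> {}" "r \<ge> 2" "\<And>x y. adj x y \<Longrightarrow> adj y x" "\<And>x. \<not> adj x x"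
    and deg: "\<And>v. v \<in> W \<Longrightarrow>
      real (card {x \<in> W. adj v x}) > (1 - 1 / real r - 1 / real r ^ 4) * real (card W)"
  shows "dense_graph W adj r"
proof
  fix v assume v: "v \<in> W"
  have "card {x \<in> W. adj v x} + card {x \<in> W. \<not> adj v x} = card W"
    using assms(1) by (subst card_Un_disjoint[symmetric]) (auto intro: arg_cong[where f = card])
  then have "real (card {x \<in> W. \<not> adj v x}) = real (card W) - card {x \<in> W. adj v x}"
    by linarith
  then show "real (card {x \<in> W. \<not> adj v x}) < (1 / real r + 1 / real r ^ 4) * real (card W)"
    using deg[OF v] by (simp add: algebra_simps)
qed (use assms in auto)

definition edge_pairs :: "('a \<Rightarrow> 'a \<Rightarrow> bool) \<Rightarrow> 'a set \<Rightarrow> ('a \<times> 'a) set" where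
  "edge_pairs adj W = {(x, y). x \<in> W \<and> y \<in> W \<and> adj x y}"

text \<open>Ordered pairs count every edge twice, so for a graph this is twice the surplus of edges
  over the Turan bound (1 - 1/r) |W|^2 / 2.\<close>

definition excess :: "('a \<Rightarrow> 'a \<Rightarrow> bool) \<Rightarrow> nat \<Rightarrow> 'a set \<Rightarrow> real" where
  "excess adj r W = real (card (edge_pairs adj W)) - (1 - 1 / real r) * real (card W) ^ 2"

lemma edge_pairs_subset: "edge_pairs adj W \<subseteq> W \<times> W"
  by (auto simp: edge_pairs_def)

lemma card_edge_pairs_remove:
  assumes "finite W" "M \<subseteq> W" and sym: "\<And>x y. adj x y \<Longrightarrow> adj y x"
  shows "card (edge_pairs adj W) \<le> card (edge_pairs adj (W - M)) + 2 * (\<Sum>v\<in>M. card {x \<in> W. adj v x})"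
proof -
  let ?S = "SIGMA v:M. {x \<in> W. adj v x}"
  have fM: "finite M"
    using assms finite_subset by blast
  have fS: "finite ?S"
    using fM assms(1) by auto
  have fE: "finite (edge_pairs adj (W - M))"
    by (rule finite_subset[OF edge_pairs_subset]) (use assms(1) in simp)
  have "edge_pairs adj W \<subseteq> edge_pairs adj (W - M) \<union> (?S \<union> prod.swap ` ?S)"
  proof
    fix p assume "p \<in> edge_pairs adj W"
    then obtain x y where p: "p = (x, y)" "x \<in> W" "y \<in> W" "adj x y"
      by (auto simp: edge_pairs_def)
    then show "p \<in> edge_pairs adj (W - M) \<union> (?S \<union> prod.swap ` ?S)"
      using sym[of x y] by (cases "y \<in> M") (auto simp: edge_pairs_def image_iff)
  qed
  then have "card (edge_pairs adj W) \<le> card (edge_pairs adj (W - M) \<union> (?S \<union> prod.swap ` ?S))"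
    using fS fE by (intro card_mono) auto
  also have "\<dots> \<le> card (edge_pairs adj (W - M)) + (card ?S + card (prod.swap ` ?S))"
    by (meson add_left_mono card_Un_le le_trans)
  also have "card (prod.swap ` ?S) = card ?S"
    by (rule card_image) auto
  also have "card ?S = (\<Sum>v\<in>M. card {x \<in> W. adj v x})"
    using fM assms(1) by (simp add: card_SigmaI)
  finally show ?thesis
    by simp
qed

text \<open>Deletion loses at most 2 |M| D ordered pairs, while the Turan term drops by (1 - 1/r) (2
  |M| |W| - |M|^2). The excess therefore rises once \<open>D\<close> is sufficiently below (1 - 1/r)
  |W|.\<close>

lemma excess_remove:
  fixes D :: real
  assumes "finite W" "M \<subseteq> W" and sym: "\<And>x y. adj x y \<Longrightarrow> adj y x"
    and deg: "\<And>v. v \<in> M \<Longrightarrow> real (card {x \<in> W. adj v x}) \<le> D"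
  shows "excess adj r (W - M) \<ge> excess adj r W - 2 * real (card M) * D
    + (1 - 1 / real r) * (2 * real (card M) * real (card W) - real (card M) ^ 2)"
proof -
  have fM: "finite M"
    using assms finite_subset by blast
  have "real (card (edge_pairs adj W)) \<le>
      real (card (edge_pairs adj (W - M)) + 2 * (\<Sum>v\<in>M. card {x \<in> W. adj v x}))"
    by (rule of_nat_mono[OF card_edge_pairs_remove[OF assms(1-3)]])
  also have "\<dots> = real (card (edge_pairs adj (W - M))) + 2 * (\<Sum>v\<in>M. real (card {x \<in> W. adj v x}))"
    by simp
  also have "(\<Sum>v\<in>M. real (card {x \<in> W. adj v x})) \<le> (\<Sum>v\<in>M. D)"
    using deg by (intro sum_mono) auto
  finally have "real (card (edge_pairs adj W)) \<le> real (card (edge_pairs adj (W - M))) + 2 * (card M * D)"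
    by simp
  moreover have "real (card (W - M)) = real (card W) - card M"
    using card_Diff_subset[OF fM assms(2)] card_mono[OF assms(1,2)] by (simp add: of_nat_diff)
  then have "real (card (W - M)) ^ 2 = real (card W) ^ 2 - (2 * real (card M) * real (card W) - real (card M) ^ 2)"
    by (simp only: power2_diff) (simp add: algebra_simps)
  ultimately show ?thesis
    unfolding excess_def by (simp add: right_diff_distrib)
qed

text \<open>A pair of vertices is an edge, a missing pair between two colours or a pair within one
  colour; the latter number |W|^2 / r plus the squared deviations from balance. Besides excess \<le>
  0, the exact identity shows that a tiny deficit forces a balanced complete multipartite
  graph.\<close>

lemma excess_colored:
  assumes "finite W" "r > 0" "\<And>x. x \<in> W \<Longrightarrow> col x < r"
    and proper: "\<And>x y. x \<in> W \<Longrightarrow> y \<in> W \<Longrightarrow> adj x y \<Longrightarrow> col x \<noteq> col y"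
  shows "excess adj r W = - (\<Sum>i<r. (real (card {x \<in> W. col x = i}) - real (card W) / real r) ^ 2)
    - real (card {(x, y). x \<in> W \<and> y \<in> W \<and> col x \<noteq> col y \<and> \<not> adj x y})"
proof -
  let ?p = "\<lambda>i. {x \<in> W. col x = i}"
  let ?miss = "{(x, y). x \<in> W \<and> y \<in> W \<and> col x \<noteq> col y \<and> \<not> adj x y}"
  let ?same = "\<Union>i<r. ?p i \<times> ?p i"
  have WW: "finite (W \<times> W)"
    using assms(1) by simp
  have fin: "finite (edge_pairs adj W)" "finite ?miss" "finite ?same"
  proof -
    show "finite (edge_pairs adj W)"
      by (rule finite_subset[OF edge_pairs_subset WW])
    show "finite ?miss"
      by (rule finite_subset[OF _ WW]) auto
    show "finite ?same"
      by (rule finite_subset[OF _ WW]) auto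
  qed
  have "W \<times> W = edge_pairs adj W \<union> (?miss \<union> ?same)"
    using assms(3) by (auto simp: edge_pairs_def)
  moreover have "edge_pairs adj W \<inter> (?miss \<union> ?same) = {}" "?miss \<inter> ?same = {}"
    using proper by (fastforce simp: edge_pairs_def)+
  ultimately have "card (W \<times> W) = card (edge_pairs adj W) + (card ?miss + card ?same)"
    using fin by (simp add: card_Un_disjoint)
  moreover have "card ?same = (\<Sum>i<r. card (?p i) ^ 2)"
    using assms(1) by (subst card_UN_disjoint) (auto simp: power2_eq_square card_cartesian_product)
  ultimately have "card W ^ 2 = card (edge_pairs adj W) + (card ?miss + (\<Sum>i<r. card (?p i) ^ 2))"
    by (simp add: power2_eq_square card_cartesian_product)
  then have "real (card W ^ 2) = real (card (edge_pairs adj W) + (card ?miss + (\<Sum>i<r. card (?p i) ^ 2)))"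
    by (rule arg_cong)
  then have 1: "real (card W) ^ 2 = card (edge_pairs adj W) + card ?miss + (\<Sum>i<r. real (card (?p i)) ^ 2)"
    by simp
  have "W = (\<Union>i<r. ?p i)"
    using assms(3) by auto
  then have "card W = card (\<Union>i<r. ?p i)"
    by simp
  also have "\<dots> = (\<Sum>i<r. card (?p i))"
    using assms(1) by (intro card_UN_disjoint) auto
  finally have "real (card W) = (\<Sum>i<r. real (card (?p i)))"
    by simp
  moreover have "(\<Sum>i<r. (real (card (?p i)) - real (card W) / real r) ^ 2) =
      (\<Sum>i<r. real (card (?p i)) ^ 2) - 2 * (real (card W) / real r) * (\<Sum>i<r. real (card (?p i)))
      + real r * (real (card W) / real r) ^ 2"
    by (simp add: power2_diff sum.distrib sum_subtractf sum_distrib_left algebra_simps)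
  ultimately have "(\<Sum>i<r. (real (card (?p i)) - real (card W) / real r) ^ 2) =
      (\<Sum>i<r. real (card (?p i)) ^ 2) - 2 * (real (card W) / real r) * real (card W)
      + real r * (real (card W) / real r) ^ 2"
    by simp
  also have "\<dots> = (\<Sum>i<r. real (card (?p i)) ^ 2) - real (card W) ^ 2 / real r"
    using assms(2) by (simp add: power2_eq_square field_simps)
  finally have "(\<Sum>i<r. (real (card (?p i)) - real (card W) / real r) ^ 2) =
      (\<Sum>i<r. real (card (?p i)) ^ 2) - real (card W) ^ 2 / real r" .
  moreover have "(1 - 1 / real r) * real (card W) ^ 2 = real (card W) ^ 2 - real (card W) ^ 2 / real r"
    by (simp add: left_diff_distrib)
  ultimately show ?thesis
    using 1 unfolding excess_def by linarith
qed

text \<open>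
  Deleting a vertex of low degree increases the excess and, as long as \<open>W\<close> is not too small, does
  not decrease the excess plus \<open>|W|\<^sup>2 / (2 r\<^sup>4)\<close>. The latter is at most \<open>|W|\<^sup>2\<close>, so that the deletion
  stops at a large set.
\<close>

lemma dense_clique_if_excess:
  assumes "r \<ge> 2" and sym: "\<And>x y. adj x y \<Longrightarrow> adj y x" and irrefl: "\<And>x. \<not> adj x x"
    and "C \<ge> real r ^ 8" "finite W" "excess adj r W > 0"
    "excess adj r W + real (card W) ^ 2 / (2 * real r ^ 4) \<ge> C"
  shows "\<exists>W'\<subseteq>W. C \<le> real (card W') ^ 2 \<and> dense_graph W' adj r \<and>
    (\<exists>K\<subseteq>W'. card K = r + 1 \<and> pairwise adj K)"
  using assms(5-)
proof (induction "card W" arbitrary: W rule: less_induct)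
  case less
  have r: "real r \<ge> 2"
    using assms(1) by simp
  define e where "e = 1 / real r ^ 4"
  define w where "w = real (card W)"
  have e: "e > 0" "e * real r ^ 4 = 1"
    using r by (auto simp: e_def)
  have \<Psi>: "excess adj r W + e / 2 * w ^ 2 \<ge> C"
    using less.prems(3) by (simp add: e_def w_def)
  have "e \<le> 1 / 2 ^ 4"
    unfolding e_def using r by (intro divide_left_mono power_mono) auto
  moreover have "1 / real r \<le> 1 / 2"
    using r by (intro divide_left_mono) auto
  ultimately have "(e / 2 - (1 - 1 / real r)) * w ^ 2 \<le> 0 * w ^ 2"
    by (intro mult_right_mono) auto
  moreover have "card (edge_pairs adj W) \<le> card (W \<times> W)"
    using less.prems(1) by (intro card_mono edge_pairs_subset) auto
  then have "real (card (edge_pairs adj W)) \<le> w ^ 2"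
    unfolding w_def card_cartesian_product power2_eq_square by (metis of_nat_mono of_nat_mult)
  ultimately have Cw: "C \<le> w ^ 2"
    using \<Psi> unfolding excess_def w_def[symmetric] by (simp add: algebra_simps)
  \<comment> \<open>The bound C \<ge> r^8 keeps |W| \<ge> r^4, that is e w \<ge> 1, throughout. A
    deletion then gains at least 2 e w - (1 - 1/r) \<ge> e w, while e w^2 / 2 drops by less than e
    w.\<close>
  have "(real r ^ 4) ^ 2 \<le> w ^ 2"
    using Cw assms(4) by (simp flip: power_mult)
  then have wr: "w \<ge> real r ^ 4"
    by (rule power2_le_imp_le) (simp add: w_def)
  have "w > 0"
    using wr r by (smt (verit) zero_less_power)
  then have "W \<noteq> {}"
    by (auto simp: w_def)
  show ?case
  proof (cases "\<forall>v\<in>W. real (card {x \<in> W. adj v x}) > (1 - 1 / real r - 1 / real r ^ 4) * w")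
    case True
    then have dense: "dense_graph W adj r"
      using less.prems(1) \<open>W \<noteq> {}\<close> assms(1) sym irrefl by (intro dense_graphI) (auto simp: w_def)
    have "\<exists>K\<subseteq>W. card K = r + 1 \<and> pairwise adj K"
    proof (rule ccontr)
      assume "\<not> ?thesis"
      then obtain col where col: "\<forall>x\<in>W. col x < r" "\<forall>x\<in>W. \<forall>y\<in>W. adj x y \<longrightarrow> col x \<noteq> col y"
        using dense_graph.colorable_if_clique_free[OF dense] by blast
      have "(\<Sum>i<r. (real (card {x \<in> W. col x = i}) - real (card W) / real r) ^ 2) \<ge> 0"
        by (rule sum_nonneg) auto
      then have "excess adj r W \<le> 0"
        using excess_colored[of W r col adj] less.prems(1) col assms(1) by simp
      then show False
        using less.prems(2) by simp
    qed
    then show ?thesis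
      using dense Cw by (auto simp: w_def)
  next
    case False
    then obtain v where v: "v \<in> W" "real (card {x \<in> W. adj v x}) \<le> (1 - 1 / real r - e) * w"
      by (auto simp: e_def not_less)
    have "excess adj r (W - {v}) \<ge> excess adj r W - 2 * real (card {v}) * ((1 - 1 / real r - e) * w)
        + (1 - 1 / real r) * (2 * real (card {v}) * w - real (card {v}) ^ 2)"
      unfolding w_def by (rule excess_remove) (use less.prems(1) v sym in \<open>auto simp: w_def\<close>)
    also have "excess adj r W - 2 * real (card {v}) * ((1 - 1 / real r - e) * w)
        + (1 - 1 / real r) * (2 * real (card {v}) * w - real (card {v}) ^ 2) =
        excess adj r W + 2 * (e * w) - (1 - 1 / real r)"
      by (simp add: algebra_simps)
    finally have "excess adj r (W - {v}) \<ge> excess adj r W + 2 * (e * w) - (1 - 1 / real r)" .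
    moreover have ew: "e * w \<ge> 1"
      using mult_left_mono[OF wr, of e] e by simp
    moreover have "1 / real r > 0"
      using r by simp
    ultimately have ex: "excess adj r (W - {v}) \<ge> excess adj r W + e * w"
      by linarith
    have smaller: "card (W - {v}) < card W"
      using v less.prems(1) by (meson card_Diff1_less)
    have "real (card (W - {v})) = w - 1"
      using v less.prems(1) \<open>w > 0\<close> by (simp add: w_def of_nat_diff Suc_leI)
    then have "e / 2 * real (card (W - {v})) ^ 2 = e / 2 * w ^ 2 - e * w + e / 2"
      by (simp only: power2_eq_square) (simp add: algebra_simps)
    moreover have Cform: "x / (2 * real r ^ 4) = e / 2 * x" for x
      by (simp add: e_def)
    ultimately have C: "excess adj r (W - {v}) + real (card (W - {v})) ^ 2 / (2 * real r ^ 4) \<ge> C"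
      using ex \<Psi> e(1) unfolding Cform by linarith
    have "excess adj r (W - {v}) > 0"
      using ex ew less.prems(2) by linarith
    then show ?thesis
      using less.hyps[of "W - {v}"] C smaller less.prems(1) by (meson Diff_subset finite_Diff order_trans)
  qed
qed

section \<open>Translation between edge sets and adjacency relations\<close>

lemma card_edge_pairs_graph:
  assumes "simple_graph G"
  shows "card (edge_pairs (\<lambda>x y. {x, y} \<in> edges G) (verts G)) = 2 * card (edges G)"
proof -
  let ?E = "edge_pairs (\<lambda>x y. {x, y} \<in> edges G) (verts G)"
  have E: "e \<subseteq> verts G \<and> card e = 2" if "e \<in> edges G" for e
    using assms that by (auto simp: simple_graph_def nsets_def)
  have fV: "finite (verts G)"
    using assms by (simp add: simple_graph_def)
  have fE: "finite (edges G)"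
    using E fV by (meson Pow_iff finite_Pow_iff finite_subset subsetI)
  have "?E = (\<Union>e\<in>edges G. {(x, y). {x, y} = e})"
    using E by (force simp: edge_pairs_def)
  moreover have c: "card {(x, y). {x, y} = e} = 2 \<and> finite {(x, y). {x, y} = e}" if e: "e \<in> edges G" for e
  proof -
    obtain a b where "e = {a, b}" "a \<noteq> b"
      using E[OF e] by (auto simp: card_2_iff)
    then have "{(x, y). {x, y} = e} = {(a, b), (b, a)}"
      by (auto simp: doubleton_eq_iff)
    then show ?thesis
      using \<open>a \<noteq> b\<close> by auto
  qed
  then have "card (\<Union>e\<in>edges G. {(x, y). {x, y} = e}) = (\<Sum>e\<in>edges G. card {(x, y). {x, y} = e})"
    using fE by (intro card_UN_disjoint) auto
  moreover have "\<dots> = (\<Sum>e\<in>edges G. 2)"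
    using c by (intro sum.cong) auto
  ultimately show ?thesis
    by simp
qed

lemma degree_eq_card_nbrs:
  assumes "simple_graph G"
  shows "degree G v = card {x \<in> verts G. {v, x} \<in> edges G}"
proof -
  have E: "e \<subseteq> verts G \<and> card e = 2" if "e \<in> edges G" for e
    using assms that by (auto simp: simple_graph_def nsets_def)
  have "{e \<in> edges G. v \<in> e} = (\<lambda>x. {v, x}) ` {x \<in> verts G. {v, x} \<in> edges G}"
  proof (intro equalityI subsetI)
    fix e assume e: "e \<in> {e \<in> edges G. v \<in> e}"
    then obtain a b where "e = {a, b}" "a \<noteq> b"
      using E[of e] by (auto simp: card_2_iff)
    with e E[of e] show "e \<in> (\<lambda>x. {v, x}) ` {x \<in> verts G. {v, x} \<in> edges G}"
      by (auto simp: insert_commute image_iff)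
  qed auto
  moreover have "inj_on (\<lambda>x. {v, x}) {x \<in> verts G. {v, x} \<in> edges G}"
    by (auto simp: inj_on_def doubleton_eq_iff)
  ultimately show ?thesis
    by (simp add: degree_def card_image)
qed

section \<open>The stability theorem\<close>

text \<open>The set \<open>Y\<close> of heads becomes the part of size \<open>t\<close>, and every
  column of \<open>L\<close> except the last is a part of size \<open>s\<close>. The last column,
  the only one whose entries may fail to be adjacent to \<open>u\<close> and \<open>v\<close>,
  supplies s - 2 vertices that form the first part together with \<open>u\<close> and
  \<open>v\<close>.\<close>

lemma K_plus_if_dense_clique:
  fixes G :: "'a graph" and r s t :: nat
  defines "adj \<equiv> \<lambda>x y. {x, y} \<in> edges G" and "B \<equiv> 2 * r ^ (r + 8)"
  assumes G: "simple_graph G" and V: "V \<subseteq> verts G" and dense: "dense_graph V adj r"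
    and K: "K \<subseteq> V" "card K = r + 1" "pairwise adj K"
    and s: "s \<ge> 2" "2 ^ (s * B ^ (r - 1)) * (s * B ^ (r - 1)) * B \<le> card V"
    and t: "t \<ge> 1" "2 ^ (s * B) * t * B \<le> card V"
  shows "\<exists>H. subgraph H G \<and> isomorphic (K_plus (replicate (r - 1) s @ [t])) H"
proof -
  interpret dense_graph V adj r
    by (rule dense)
  obtain u v T where uv: "u \<in> V" "v \<in> V" "adj u v"
    and T: "\<And>l. l \<in> T \<Longrightarrow> length l = r \<and> set l \<subseteq> V \<and> sorted_wrt adj l \<and>
       (\<forall>w\<in>set (butlast l). adj u w \<and> adj v w)"
    and cT: "real (card T) \<ge> N ^ r / real r ^ (r + 7)"
    using joint_lists[OF K] by metis
  obtain k where k: "r = Suc k" "k \<ge> 1"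
    using r_ge by (cases r) auto
  have B: "B > 0"
    using r_ge by (simp add: B_def)
  have cV: "card V > 0"
    using finite_V V_ne by (simp add: card_gt_0_iff)
  have "real (card T) \<ge> real (Suc k) * (2 / real B) * real (card V) ^ Suc k"
  proof -
    \<comment> \<open>The choice of \<open>B\<close> makes the density 1 / r^(r+7) from
      \<open>joint_lists\<close> worth exactly the \<open>r\<close> shares of 2 / B that the levels
      consume.\<close>
    have "real r * (2 / real B) = 1 / real r ^ (r + 7)"
      using r_ge by (simp add: B_def field_simps power_add power_numeral_reduce)
    then show ?thesis
      using cT k(1) by (simp add: N_def)
  qed
  moreover have "2 ^ (s * B ^ k) * (s * B ^ k) * B \<le> card V"
    using s(2) k(1) by simp
  moreover have pow: "s * B * B ^ (k - 1) = s * B ^ k"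
    using k(2) by (cases k) auto
  ultimately obtain L Y where L: "card L = s" "matched adj k L" and Y: "Y \<subseteq> V" "card Y = t"
    and ext: "\<And>l y. l \<in> L \<Longrightarrow> y \<in> Y \<Longrightarrow> y # l \<in> T"
    and len: "\<And>l. l \<in> L \<Longrightarrow> length l = k \<and> set l \<subseteq> V"
  proof (atomize_elim, goal_cases)
    case 1
    show ?case
    proof (rule extend_matched[OF finite_V cV B _ 1(1) t(2)])
      show "length l = Suc k \<and> set l \<subseteq> V \<and> sorted_wrt adj l" if "l \<in> T" for l
        using T that k(1) by blast
      show "\<exists>L\<subseteq>G. card L = s * B \<and> matched adj k L"
        if "\<And>l. l \<in> G \<Longrightarrow> length l = k \<and> set l \<subseteq> V \<and> sorted_wrt adj l"
          "real (card G) \<ge> real k * (2 / real B) * real (card V) ^ k" for G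
        using matched_family[OF finite_V cV B sym k(2) that, of "s * B"] 1(2) by (simp only: pow)
    qed blast
  qed
  have fL: "finite L"
    using L by (simp add: matched_def)
  define C where "C a = (\<lambda>l. l ! a) ` L" for a
  have cC: "card (C a) = s" if "a < k" for a
    using L that unfolding C_def by (subst card_image) (auto simp: matched_def)
  have CV: "C a \<subseteq> V" if "a < k" for a
    using len that nth_mem by (fastforce simp: C_def)
  have Cadj: "adj x y" if "a < k" "b < k" "a \<noteq> b" "x \<in> C a" "y \<in> C b" for a b x y
    using that L(2) by (auto simp: C_def matched_def)
  have YC: "adj y x" if y: "y \<in> Y" and x: "x \<in> C a" "a < k" for a x y
  proof -
    obtain l where l: "l \<in> L" "x = l ! a"
      using x by (auto simp: C_def)
    then show ?thesis
      using T[OF ext[OF l(1) y]] len[OF l(1)] x by auto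
  qed
  \<comment> \<open>As \<open>l\<close> is nonempty, \<open>y\<close> is not the last entry of
    \<open>y # l\<close> and is therefore adjacent to \<open>u\<close> and \<open>v\<close>.\<close>
  have uvY: "adj u y \<and> adj v y" if y: "y \<in> Y" for y
  proof -
    obtain l where l: "l \<in> L"
      using L(1) s(1) by fastforce
    then have "l \<noteq> []"
      using len k(2) by fastforce
    then show ?thesis
      using T[OF ext[OF l y]] by simp
  qed
  have uvC: "adj u x \<and> adj v x" if x: "x \<in> C a" "a < k - 1" for a x
  proof -
    obtain y where y: "y \<in> Y"
      using Y(2) t(1) by fastforce
    obtain l where l: "l \<in> L" "x = l ! a"
      using x by (auto simp: C_def)
    have "l \<noteq> []"
      using len[OF l(1)] k(2) by auto
    moreover have "x \<in> set (butlast l)"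
      using l(2) x(2) len[OF l(1)] by (auto simp: in_set_conv_nth nth_butlast intro!: exI[of _ a])
    ultimately show ?thesis
      using T[OF ext[OF l(1) y]] by simp
  qed
  \<comment> \<open>\<open>u\<close> and \<open>v\<close> may occur in the last column themselves
    and are removed before the other s - 2 vertices are chosen.\<close>
  have "card (C (k - 1) - {u, v}) \<ge> s - 2"
  proof -
    have "card (C (k - 1)) - card {u, v} \<le> card (C (k - 1) - {u, v})"
      by (rule diff_card_le_card_Diff) simp
    moreover have "card {u, v} \<le> 2"
      by (simp add: card_insert_if)
    ultimately show ?thesis
      using cC[of "k - 1"] k(2) by simp
  qed
  then obtain X where X: "X \<subseteq> C (k - 1) - {u, v}" "card X = s - 2" "finite X"
    by (rule obtain_subset_with_card_n)
  define P where "P i = (if i = 0 then insert u (insert v X) else if i = k then Y else C (i - 1))" for i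
  have "u \<noteq> v"
    using uv irrefl by auto
  have ss: "(replicate (r - 1) s @ [t]) ! i = (if i = k then t else s)" if "i < r" for i
    using that k(1) by (auto simp: nth_append)
  have low: "adj x y" if "i < j" "j \<le> k" "x \<in> P i" "y \<in> P j" for i j x y
  proof (cases "i = 0")
    case False
    then show ?thesis
      using that Cadj[of "i - 1" "j - 1" x y] YC[of y x "i - 1"] sym[of y x] by (auto simp: P_def split: if_splits)
  next
    case True
    show ?thesis
    proof (cases "x \<in> X")
      case True
      then have "x \<in> C (k - 1)"
        using X by auto
      then show ?thesis
        using that Cadj[of "k - 1" "j - 1" x y] YC[of y x "k - 1"] sym[of y x] k(2)
        by (auto simp: P_def split: if_splits)
    next
      case False
      then have x: "x = u \<or> x = v"
        using that \<open>i = 0\<close> by (auto simp: P_def)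
      show ?thesis
      proof (cases "j = k")
        case True
        then show ?thesis
          using x uvY[of y] that by (auto simp: P_def)
      next
        case False
        then show ?thesis
          using x uvC[of y "j - 1"] that by (auto simp: P_def split: if_splits)
      qed
    qed
  qed
  show ?thesis
  proof (rule K_plus_embedding[OF G, where P = P and u = u and v = v])
    show "P i \<subseteq> verts G" if "i < length (replicate (r - 1) s @ [t])" for i
    proof -
      have "X \<subseteq> V"
        using X(1) CV[of "k - 1"] k(2) by auto
      moreover have "C (i - 1) \<subseteq> V" if "i \<noteq> 0" "i \<noteq> k"
        using CV[of "i - 1"] that \<open>i < length (replicate (r - 1) s @ [t])\<close> k by simp
      ultimately have "P i \<subseteq> V"
        using uv Y(1) by (simp add: P_def)
      then show ?thesis
        using V by simp
    qed
    show "card (P i) = (replicate (r - 1) s @ [t]) ! i" if "i < length (replicate (r - 1) s @ [t])" for i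
    proof -
      have "i < r"
        using that r_ge by simp
      then show ?thesis
        using X \<open>u \<noteq> v\<close> s(1) k Y(2) cC[of "i - 1"]
        by (subst ss) (auto simp: P_def card_insert_if)
    qed
    show "{x, y} \<in> edges G"
      if "i < length (replicate (r - 1) s @ [t])" "j < length (replicate (r - 1) s @ [t])" "i \<noteq> j"
        "x \<in> P i" "y \<in> P j" for i j x y
    proof -
      have ij: "i \<le> k" "j \<le> k"
        using that(1,2) k by auto
      have "adj x y"
      proof (cases "i < j")
        case True
        then show ?thesis using low that ij by blast
      next
        case False
        then show ?thesis using low[of j i y x] sym[of y x] that ij by auto
      qed
      then show ?thesis
        by (simp add: adj_def)
    qed
    show "{u, v} \<in> edges G"
      using uv by (simp add: adj_def)
  qed (auto simp: P_def)
qed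

theorem theorem3:
  fixes r n :: nat and c \<alpha> :: real and G :: "'a graph"
  assumes "r \<ge> 2"
    and "n > 0"
    and "2 / ln (real n) \<le> c"
    and "c \<le> real r powi (- int ((r + 7) * (r + 1))) / 2"
    and "0 < \<alpha>"
    and "\<alpha> < real r powi (-8) / 8"
    and "simple_graph G"
    and "card (verts G) = n"
    and "int (card (edges G)) = \<lceil>(1 - 1 / real r - \<alpha>) * (real n)\<^sup>2 / 2\<rceil>"
  shows
    "(\<exists>H. subgraph H G \<and>
        isomorphic
          (K_plus (replicate (r - 1) (nat \<lfloor>c * ln (real n)\<rfloor>) @
                   [nat \<lceil>real n powr (1 - 2 * sqrt c)\<rceil>])) H) \<or>
     (\<exists>G0. induced_subgraph G0 G \<and> partite r G0 \<and>
        real (card (verts G0)) \<ge> (1 - sqrt (2 * \<alpha>)) * real n \<and>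
        real (min_degree G0) > (1 - 1 / real r - 2 * sqrt (2 * \<alpha>)) * real n)"
    (is "?i \<or> ?ii")
proof -
  define adj where "adj = (\<lambda>x y. {x, y} \<in> edges G)"
  define V where "V = verts G"
  define \<gamma> where "\<gamma> = sqrt (2 * \<alpha>)"
  define x where "x = \<gamma> * real n"
  define s where "s = nat \<lfloor>c * ln (real n)\<rfloor>"
  define t where "t = nat \<lceil>real n powr (1 - 2 * sqrt c)\<rceil>"
  note r2 = \<open>r \<ge> 2\<close>
  have r: "real r \<ge> 2"
    using r2 by simp
  have G: "simple_graph G"
    by fact
  have E: "e \<subseteq> V \<and> card e = 2" if "e \<in> edges G" for e
    using G that by (auto simp: simple_graph_def nsets_def V_def)
  have fV: "finite V" and cV: "card V = n"
    using G \<open>card (verts G) = n\<close> by (auto simp: simple_graph_def V_def)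
  have sym: "adj a b \<Longrightarrow> adj b a" for a b
    by (simp add: adj_def insert_commute)
  have irrefl: "\<not> adj a a" for a
    using E[of "{a}"] by (auto simp: adj_def)
  have r4: "real r ^ 4 \<ge> 16" and r4': "1 / real r ^ 4 \<le> 1 / 16" and r1: "1 / real r \<le> 1 / 2"
  proof -
    show *: "real r ^ 4 \<ge> 16"
      using power_mono[OF r, of 4] by simp
    show "1 / real r ^ 4 \<le> 1 / 16"
      using * r by (intro divide_left_mono) auto
    show "1 / real r \<le> 1 / 2"
      using r by (intro divide_left_mono) auto
  qed
  have \<alpha>: "\<alpha> < (1 / real r ^ 4) ^ 2 / 8"
  proof -
    have "real r powi (-8) = (1 / real r ^ 4) ^ 2"
      using power_int_minus[of "real r" 8] by (simp add: power_one_over field_simps flip: power_mult)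
    then show ?thesis
      using \<open>\<alpha> < real r powi (-8) / 8\<close> by simp
  qed
  have \<gamma>: "\<gamma> > 0" "\<gamma> ^ 2 = 2 * \<alpha>"
    using \<open>0 < \<alpha>\<close> by (auto simp: \<gamma>_def)
  \<comment> \<open>The bound on \<alpha> amounts to 2 x < n / r^4, so the degree loss of 2 x
    allowed in (ii) stays within the slack of \<open>dense_graph\<close>.\<close>
  have \<gamma>2: "2 * \<gamma> < 1 / real r ^ 4"
  proof (rule power2_less_imp_less)
    show "(2 * \<gamma>) ^ 2 < (1 / real r ^ 4) ^ 2"
      using \<gamma>(2) \<alpha> by (simp add: power_mult_distrib)
  qed simp
  have "real (card (edges G)) \<ge> (1 - 1 / real r - \<alpha>) * (real n)\<^sup>2 / 2"
    using assms(9) by (metis le_of_int_ceiling of_int_of_nat_eq)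
  then have ed: "2 * real (card (edges G)) \<ge> (1 - 1 / real r - \<alpha>) * (real n)\<^sup>2"
    by simp
  have "\<alpha> < 1 / 4"
  proof -
    have "(1 / real r ^ 4) ^ 2 \<le> 1 ^ 2"
      using r4' by (intro power_mono) auto
    then show ?thesis
      using \<alpha> by simp
  qed
  \<comment> \<open>For \<open>n = 1\<close> the lower bound on \<open>c\<close> degenerates to 0
    \<le> c, since division by zero yields 0. The existence of an edge excludes this case.\<close>
  have n2: "n \<ge> 2"
  proof -
    have "(1 - 1 / real r - \<alpha>) * (real n)\<^sup>2 > 0"
      using r1 \<open>\<alpha> < 1 / 4\<close> \<open>n > 0\<close> by simp
    then have "card (edges G) > 0"
      using ed by linarith
    then obtain e where "e \<in> edges G"
      by (metis card_gt_0_iff ex_in_conv)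
    then show ?thesis
      using card_mono[OF fV, of e] E[of e] cV by simp
  qed
  note params = parameter_bounds[OF r2 n2 assms(3,4), folded s_def t_def]
  have nbig: "real n \<ge> 4 * real r ^ 16"
  proof -
    have "4 * r ^ 16 \<le> 4 * r ^ (2 * r + 16)"
      using r2 by (intro mult_left_mono power_increasing) auto
    also have "\<dots> = (2 * r ^ (r + 8)) ^ 2"
      by (simp add: power_mult_distrib mult.commute[of r] flip: power_mult)
    also have "\<dots> \<le> n"
      by (rule params(2))
    finally show ?thesis
      by (metis of_nat_mono of_nat_mult of_nat_numeral of_nat_power)
  qed
  have nr4: "real n / real r ^ 4 \<ge> 4"
  proof -
    have "4 * real r ^ 4 \<le> 4 * real r ^ 16"
      using r by (intro mult_left_mono power_increasing) auto
    then have "4 * real r ^ 4 \<le> real n"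
      using nbig by linarith
    then show ?thesis
      using r by (simp add: field_simps)
  qed
  have x: "x > 0" "x ^ 2 = 2 * \<alpha> * real n ^ 2" "2 * x < real n / real r ^ 4"
    using \<gamma> \<gamma>2 \<open>n > 0\<close> mult_strict_right_mono[OF \<gamma>2, of "real n"] by (auto simp: x_def power_mult_distrib)
  have xn: "2 * x \<le> real n"
  proof -
    have "real n / real r ^ 4 \<le> real n / 1"
      using r4 r2 by (intro divide_left_mono) auto
    then show ?thesis
      using x(3) by simp
  qed
  \<comment> \<open>\<open>x\<close> is chosen so that the deficit \<alpha> n^2 permitted by the
    number of edges is x^2 / 2.\<close>
  have excessV: "excess adj r V \<ge> - (x ^ 2 / 2)"
    using ed card_edge_pairs_graph[OF G] cV unfolding excess_def adj_def V_def x(2)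
    by (simp add: algebra_simps)
  have win: ?i if W: "W \<subseteq> V" "dense_graph W adj r" "n \<le> card W * r ^ 4"
    and K: "K \<subseteq> W" "card K = r + 1" "pairwise adj K" for W K
  proof -
    have "t \<ge> 1"
    proof -
      have "real n powr (1 - 2 * sqrt c) > 0"
        using \<open>n > 0\<close> by simp
      then show ?thesis
        unfolding t_def by linarith
    qed
    have dense: "dense_graph W (\<lambda>x y. {x, y} \<in> edges G) r"
      using W(2) unfolding adj_def .
    have K3: "pairwise (\<lambda>x y. {x, y} \<in> edges G) K"
      using K(3) unfolding adj_def .
    show ?thesis
      using K_plus_if_dense_clique[OF G W(1)[unfolded V_def] dense K(1,2) K3 params(1)
          params(3)[OF W(3)] \<open>t \<ge> 1\<close> params(4)[OF W(3)]]
      unfolding s_def t_def .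
  qed
  have pos: ?i if W: "W \<subseteq> V" "excess adj r W > 0" "real n \<le> 2 * real (card W)" for W
  proof -
    \<comment> \<open>As |W| \<ge> n / 2, the term |W|^2 / (2 r^4) alone reaches \<open>C\<close>.
      The set \<open>W'\<close> found then satisfies n^2 \<le> 8 r^4 |W'|^2 \<le> r^8 |W'|^2, the
      size that \<open>win\<close> asks for.\<close>
    define C where "C = real n ^ 2 / (8 * real r ^ 4)"
    have "C \<ge> real r ^ 8"
    proof -
      have "8 * real r ^ 12 \<le> 8 * real r ^ 16"
        using r by (intro mult_left_mono power_increasing) auto
      also have "\<dots> \<le> 2 * real n"
        using nbig by simp
      also have "\<dots> \<le> real n * real n"
        using n2 by (intro mult_right_mono) auto
      finally have "8 * real r ^ 4 * real r ^ 8 \<le> real n ^ 2"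
        by (simp add: power2_eq_square mult.assoc flip: power_add)
      then show ?thesis
        using r by (simp add: C_def field_simps)
    qed
    moreover have "excess adj r W + real (card W) ^ 2 / (2 * real r ^ 4) \<ge> C"
    proof -
      have "real n ^ 2 \<le> (2 * real (card W)) ^ 2"
        using W(3) by (intro power_mono) auto
      then have "real n ^ 2 / (8 * real r ^ 4) \<le> (2 * real (card W)) ^ 2 / (8 * real r ^ 4)"
        by (intro divide_right_mono) auto
      also have "\<dots> = real (card W) ^ 2 / (2 * real r ^ 4)"
        using r by (simp add: field_simps power2_eq_square)
      finally show ?thesis
        using W(2) by (simp add: C_def)
    qed
    moreover have "finite W"
      using W(1) fV finite_subset by blast
    ultimately obtain W' K where W': "W' \<subseteq> W" "C \<le> real (card W') ^ 2" "dense_graph W' adj r"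
      and K: "K \<subseteq> W'" "card K = r + 1" "pairwise adj K"
      using dense_clique_if_excess[of r adj C W, OF r2 sym irrefl] W(2) by blast
    have "real n ^ 2 \<le> 8 * real r ^ 4 * real (card W') ^ 2"
      using W'(2) r unfolding C_def by (simp add: field_simps)
    also have "\<dots> \<le> (real r ^ 4 * real r ^ 4) * real (card W') ^ 2"
      using r4 by (intro mult_right_mono) auto
    also have "\<dots> = (real (card W') * real r ^ 4) ^ 2"
      by (simp add: power2_eq_square)
    finally have "real n \<le> real (card W') * real r ^ 4"
      by (rule power2_le_imp_le) simp
    then have "n \<le> card W' * r ^ 4"
      by (metis of_nat_le_iff of_nat_mult of_nat_power)
    then show ?thesis
      using win[of W' K] W W' K by blast
  qed
  have induced: ?ii if W: "W \<subseteq> V" "W \<noteq> {}" "real (card W) \<ge> real n - x"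
    and col: "\<And>v. v \<in> W \<Longrightarrow> col v < r" "\<And>v w. v \<in> W \<Longrightarrow> w \<in> W \<Longrightarrow> adj v w \<Longrightarrow> col v \<noteq> col w"
    and deg: "\<And>v. v \<in> W \<Longrightarrow> real (card {w \<in> W. adj v w}) > (1 - 1 / real r) * real n - 2 * x" for W col
  proof (rule exI[of _ "(W, {e \<in> edges G. e \<subseteq> W})"], intro conjI)
    let ?G = "(W, {e \<in> edges G. e \<subseteq> W})"
    have fW: "finite W"
      using W(1) fV finite_subset by blast
    show "induced_subgraph ?G G"
      using W(1) by (simp add: induced_subgraph_def V_def)
    show "partite r ?G"
      unfolding partite_def using col by (intro exI[of _ col]) (auto simp: adj_def)
    show "real (card (verts ?G)) \<ge> (1 - sqrt (2 * \<alpha>)) * real n"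
      using W(3) by (simp add: x_def \<gamma>_def algebra_simps)
    have "simple_graph ?G"
      using G fW by (auto simp: simple_graph_def nsets_def)
    have "min_degree ?G \<in> degree ?G ` W"
      unfolding min_degree_def using fW W(2) by simp
    then obtain v where v: "v \<in> W" "min_degree ?G = degree ?G v"
      by blast
    have "degree ?G v = card {w \<in> W. adj v w}"
      using degree_eq_card_nbrs[OF \<open>simple_graph ?G\<close>, of v] v(1) by (auto simp: adj_def intro: arg_cong[where f = card])
    then show "real (min_degree ?G) > (1 - 1 / real r - 2 * sqrt (2 * \<alpha>)) * real n"
      using deg[OF v(1)] v(2) by (simp add: x_def \<gamma>_def algebra_simps)
  qed
  have "V \<noteq> {}"
    using cV \<open>n > 0\<close> by auto
  show ?thesis
  proof (cases "x < 1")
    \<comment> \<open>An order of at least n - x > n - 1 leaves no vertex to delete, so (ii) can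
      only be attained by \<open>V\<close> itself.\<close>
    case True
    then have x1: "x ^ 2 < 1"
      using x(1) power_less_one_iff[of x 2] by simp
    show ?thesis
    proof (cases "\<forall>v\<in>V. real (card {w \<in> V. adj v w}) > (1 - 1 / real r - 1 / real r ^ 4) * real n")
      case True
      then have dense: "dense_graph V adj r"
        using fV \<open>V \<noteq> {}\<close> r2 sym irrefl cV by (intro dense_graphI) auto
      show ?thesis
      proof (cases "\<exists>K\<subseteq>V. card K = r + 1 \<and> pairwise adj K")
        case True
        have "n * 1 \<le> card V * r ^ 4"
          using cV r2 by (intro mult_le_mono) auto
        then show ?thesis
          using win[of V] dense True by auto
      next
        case False
        then obtain col where "\<forall>v\<in>V. col v < r" "\<forall>v\<in>V. \<forall>w\<in>V. adj v w \<longrightarrow> col v \<noteq> col w"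
          using dense_graph.colorable_if_clique_free[OF dense] by blast
        then have col: "\<And>v. v \<in> V \<Longrightarrow> col v < r"
          "\<And>v w. v \<in> V \<Longrightarrow> w \<in> V \<Longrightarrow> adj v w \<Longrightarrow> col v \<noteq> col w"
          by blast+
        let ?p = "\<lambda>i. real (card {w \<in> V. col w = i})"
        let ?miss = "{(v, w). v \<in> V \<and> w \<in> V \<and> col v \<noteq> col w \<and> \<not> adj v w}"
        have ex: "(\<Sum>i<r. (?p i - real n / real r) ^ 2) + real (card ?miss) \<le> x ^ 2 / 2"
          using excess_colored[of V r col adj] fV r2 col excessV cV by simp
        moreover have "(\<Sum>i<r. (?p i - real n / real r) ^ 2) \<ge> 0"
          by (rule sum_nonneg) auto
        \<comment> \<open>A cardinality below 1 is 0, so all pairs between colours are edges. The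
          same inequality bounds each part by n / r + x and hence all degrees from below.\<close>
        ultimately have "real (card ?miss) < 1"
          using x1 by linarith
        moreover have "finite ?miss"
          using fV by (auto intro: finite_subset[of _ "V \<times> V"])
        ultimately have miss: "?miss = {}"
          by simp
        have "real (card {w \<in> V. adj v w}) > (1 - 1 / real r) * real n - 2 * x" if v: "v \<in> V" for v
        proof -
          have "(?p (col v) - real n / real r) ^ 2 \<le> (\<Sum>i<r. (?p i - real n / real r) ^ 2)"
            using col(1)[OF v] by (intro member_le_sum) auto
          also have "\<dots> \<le> x ^ 2"
            using ex zero_le_power2[of x] by linarith
          finally have "?p (col v) - real n / real r \<le> x"
            by (rule power2_le_imp_le) (use x(1) in simp)
          moreover have "adj v w \<longleftrightarrow> col w \<noteq> col v" if w: "w \<in> V" for w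
          proof
            show "adj v w \<Longrightarrow> col w \<noteq> col v"
              using col(2)[OF v w] by simp
            have "(v, w) \<notin> ?miss"
              by (simp only: miss empty_iff not_False_eq_True)
            then show "col w \<noteq> col v \<Longrightarrow> adj v w"
              using v w by simp
          qed
          then have "{w \<in> V. adj v w} = V - {w \<in> V. col w = col v}"
            by auto
          then have "card {w \<in> V. adj v w} = n - card {w \<in> V. col w = col v}"
            using fV cV by (simp add: card_Diff_subset)
          then have "real (card {w \<in> V. adj v w}) \<ge> real n - ?p (col v)"
            by linarith
          ultimately show ?thesis
            using x(1) by (simp add: algebra_simps)
        qed
        then show ?thesis
          using induced[OF subset_refl \<open>V \<noteq> {}\<close> _ col] cV x(1) by simp
      qed
    next
      \<comment> \<open>Deleting one vertex of low degree raises the excess by at least 2 n / r^4 -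
        (1 - 1/r) > 7, more than the deficit x^2 / 2 < 1/2.\<close>
      case False
      then obtain v where v: "v \<in> V" "real (card {w \<in> V. adj v w}) \<le> (1 - 1 / real r - 1 / real r ^ 4) * real n"
        by (auto simp: not_less)
      have "excess adj r (V - {v}) \<ge> excess adj r V
          - 2 * real (card {v}) * ((1 - 1 / real r - 1 / real r ^ 4) * real n)
          + (1 - 1 / real r) * (2 * real (card {v}) * real (card V) - real (card {v}) ^ 2)"
        by (rule excess_remove) (use fV v sym in auto)
      also have "excess adj r V
          - 2 * real (card {v}) * ((1 - 1 / real r - 1 / real r ^ 4) * real n)
          + (1 - 1 / real r) * (2 * real (card {v}) * real (card V) - real (card {v}) ^ 2)
          = excess adj r V + 2 * (real n / real r ^ 4) - (1 - 1 / real r)"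
        using cV by (simp add: algebra_simps)
      finally have "excess adj r (V - {v}) \<ge> excess adj r V + 2 * (real n / real r ^ 4) - (1 - 1 / real r)" .
      moreover have "1 / real r > 0"
        using r by simp
      ultimately have "excess adj r (V - {v}) > 0"
        using excessV x1 nr4 by linarith
      moreover have "real n \<le> 2 * real (card (V - {v}))"
        using v(1) fV cV n2 by (simp add: of_nat_diff)
      ultimately show ?thesis
        using pos[of "V - {v}"] by blast
    qed
  next
    case False
    \<comment> \<open>The threshold serves both cases: vertices outside \<open>M\<close> keep degree
      above (1 - 1/r) n - 2 x when at most \<open>x\<close> vertices are deleted, and vertices in
      \<open>M\<close> are poor enough for deleting about \<open>x\<close> of them to outweigh the
      deficit.\<close>
    define M where "M = {v \<in> V. real (card {w \<in> V. adj v w}) \<le> (1 - 1 / real r) * real n - x}"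
    have MV: "M \<subseteq> V" and fM: "finite M"
      using fV by (auto simp: M_def)
    show ?thesis
    proof (cases "real (card M) \<le> x")
      case True
      have cW: "real (card (V - M)) \<ge> real n - x"
        using True card_Diff_subset[OF fM MV] card_mono[OF fV MV] cV by (simp add: of_nat_diff)
      have deg: "real (card {w \<in> V - M. adj v w}) > (1 - 1 / real r) * real n - 2 * x" if v: "v \<in> V - M" for v
      proof -
        have "card {w \<in> V. adj v w} \<le> card ({w \<in> V - M. adj v w} \<union> M)"
          using fV fM by (intro card_mono) auto
        also have "\<dots> \<le> card {w \<in> V - M. adj v w} + card M"
          by (rule card_Un_le)
        finally have "real (card {w \<in> V. adj v w}) \<le> real (card {w \<in> V - M. adj v w}) + card M"
          by linarith
        moreover have "real (card {w \<in> V. adj v w}) > (1 - 1 / real r) * real n - x"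
          using v by (auto simp: M_def)
        ultimately show ?thesis
          using True by linarith
      qed
      have ne: "V - M \<noteq> {}"
      proof
        assume "V - M = {}"
        then have "real (card (V - M)) = 0"
          by (simp only: card.empty of_nat_0)
        then show False
          using cW xn x(1) by linarith
      qed
      have dense: "dense_graph (V - M) adj r"
      proof (rule dense_graphI)
        fix v assume "v \<in> V - M"
        have "(1 - 1 / real r - 1 / real r ^ 4) * real (card (V - M)) \<le> (1 - 1 / real r - 1 / real r ^ 4) * real n"
          using r1 r4' card_mono[OF fV, of "V - M"] cV by (intro mult_left_mono) auto
        also have "\<dots> = (1 - 1 / real r) * real n - real n / real r ^ 4"
          by (simp add: algebra_simps)
        also have "\<dots> < (1 - 1 / real r) * real n - 2 * x"
          using x(3) by simp
        also have "\<dots> < card {w \<in> V - M. adj v w}"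
          by (rule deg) fact
        finally show "(1 - 1 / real r - 1 / real r ^ 4) * real (card (V - M)) < card {w \<in> V - M. adj v w}" .
      qed (use fV ne r2 sym irrefl in auto)
      show ?thesis
      proof (cases "\<exists>K\<subseteq>V - M. card K = r + 1 \<and> pairwise adj K")
        case True
        have "real n \<le> 2 * real (card (V - M))"
          using cW xn by linarith
        also have "\<dots> \<le> real r ^ 4 * real (card (V - M))"
          using r4 by (intro mult_right_mono) auto
        finally have "n \<le> card (V - M) * r ^ 4"
          by (metis mult.commute of_nat_le_iff of_nat_mult of_nat_power)
        then show ?thesis
          using win[of "V - M"] dense True by auto
      next
        case False
        then obtain col where "\<forall>v\<in>V - M. col v < r" "\<forall>v\<in>V - M. \<forall>w\<in>V - M. adj v w \<longrightarrow> col v \<noteq> col w"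
          using dense_graph.colorable_if_clique_free[OF dense] by blast
        then have col: "\<And>v. v \<in> V - M \<Longrightarrow> col v < r"
          "\<And>v w. v \<in> V - M \<Longrightarrow> w \<in> V - M \<Longrightarrow> adj v w \<Longrightarrow> col v \<noteq> col w"
          by blast+
        then show ?thesis
          using induced[of "V - M" col, OF _ ne cW col deg] by blast
      qed
    next
      case M: False
      \<comment> \<open>Because x \<ge> 1, rounding down keeps m \<ge> x / 2. The gain m (2 x - m)
        is then at least x^2 / 2 and cancels the deficit, and the extra m^2 / r makes the excess
        strictly positive.\<close>
      define m where "m = real (nat \<lfloor>x\<rfloor>)"
      have m: "m \<le> x" "2 * m \<ge> x"
      proof -
        have "1 \<le> \<lfloor>x\<rfloor>"
          using False by (simp add: le_floor_iff)
        then have "m = of_int \<lfloor>x\<rfloor>" "m \<ge> 1"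
          by (simp_all add: m_def)
        then show "m \<le> x" "2 * m \<ge> x"
          by linarith+
      qed
      have "nat \<lfloor>x\<rfloor> \<le> card M"
        using M m(1) unfolding m_def by linarith
      then obtain M' where M': "M' \<subseteq> M" "card M' = nat \<lfloor>x\<rfloor>" "finite M'"
        by (rule obtain_subset_with_card_n)
      have cM': "real (card M') = m"
        using M'(2) by (simp add: m_def)
      have "excess adj r (V - M') \<ge> excess adj r V
          - 2 * real (card M') * ((1 - 1 / real r) * real n - x)
          + (1 - 1 / real r) * (2 * real (card M') * real (card V) - real (card M') ^ 2)"
        by (rule excess_remove) (use fV M' MV sym in \<open>auto simp: M_def\<close>)
      also have "excess adj r V
          - 2 * real (card M') * ((1 - 1 / real r) * real n - x)
          + (1 - 1 / real r) * (2 * real (card M') * real (card V) - real (card M') ^ 2)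
          = excess adj r V + m * (2 * x - m) + m ^ 2 / real r"
        using cV unfolding cM' by (simp add: algebra_simps power2_eq_square)
      finally have "excess adj r (V - M') \<ge> excess adj r V + m * (2 * x - m) + m ^ 2 / real r" .
      moreover have "m * (2 * x - m) \<ge> x / 2 * x"
        using m x(1) by (intro mult_mono) auto
      moreover have "m ^ 2 / real r > 0"
        using m x(1) r by simp
      ultimately have "excess adj r (V - M') > 0"
        using excessV by (simp add: power2_eq_square)
      moreover have "real n \<le> 2 * real (card (V - M'))"
        using cM' m(1) xn card_Diff_subset[of M' V] card_mono[OF fV, of M'] M' MV cV by (simp add: of_nat_diff)
      ultimately show ?thesis
        using pos[of "V - M'"] by blast
    qed
  qed
qed

end
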